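(* Let $(\Omega,\mathscr F,\mathsf P)$ be a probability space equipped with a discrete-time filtration $(\mathscr F_t)_{t\in\mathbb N_0}$, $\mathscr F_t\subset\mathscr F$, let $d\in\mathbb N$, and let $S=(S_t)_{t\in\mathbb N_0}$ be a $d$-dimensional $\mathsf P$-local martingale. Then for every $\varepsilon>0$ there exists a probability measure $\mathsf Q$ on $(\Omega,\mathscr F)$, equivalent to $\mathsf P$, such that $S$ is a $\mathsf Q$-martingale, $\|\mathsf P-\mathsf Q\|<\varepsilon$, and $\mathsf E_{\mathsf Q}[|S_t|^p]<\infty$ for all $t\in\mathbb N_0$ and all $p\in\mathbb N$.
   Context: $\mathbb N=\{1,2,\dots\}$, $\mathbb N_0=\mathbb N\cup\{0\}$; $|\cdot|$ is the Euclidean norm (absolute value in dimension one). Relations between random variables are understood almost surely. For two equivalent probability measures $\mathsf Q_1,\mathsf Q_2$, the total variation norm is $\|\mathsf Q_1-\mathsf Q_2\|=\mathsf E_{\mathsf Q_1}\left[\left|\frac{d\mathsf Q_2}{d\mathsf Q_1}-1\right|\right]$. For a stopping time $\tau$ (with values in $\mathbb N_0\cup\{\infty\}$) and a process $X$, $X^\tau$ denotes the process $X$ stopped at $\tau$, i.e. $X^\tau_t=X_{t\wedge\tau}$. For a probability measure $\mathsf R$ on $(\Omega,\mathscr F)$, a stochastic process $X=(X_t)_{t\in\mathbb N_0}$ is an $\mathsf R$-martingale if $\mathsf E_{\mathsf R}[|X_t|]<\infty$ and $\mathsf E_{\mathsf R}[X_{t+1}\mid\mathscr F_t]=X_t$ for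 all $t\in\mathbb N_0$. It is an $\mathsf R$-local martingale if there exists a sequence $(\tau_n)_{n\in\mathbb N}$ of stopping times such that $\lim_{n\uparrow\infty}\tau_n=\infty$ and $X^{\tau_n}\mathbf 1_{\{\tau_n>0\}}$ is an $\mathsf R$-martingale for each $n\in\mathbb N$. *)

theory Defs
  imports "HOL-Probability.Probability"
begin

definition equivalent_measures :: "'a measure \<Rightarrow> 'a measure \<Rightarrow> bool" where
  "equivalent_measures M N \<longleftrightarrow>
     sets M = sets N \<and> absolutely_continuous M N \<and> absolutely_continuous N M"

text \<open>
  This is \<open>E\<^sub>M[\<bar>dN/dM - 1\<bar>]\<close>, without a factor \<open>1/2\<close>; it is meant for equivalent probability
  measures, for which \<open>RN_deriv M N\<close> is almost surely finite and the integrand is integrable.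
\<close>
definition tv_norm :: "'a measure \<Rightarrow> 'a measure \<Rightarrow> real" where
  "tv_norm M N = (\<integral>\<omega>. \<bar>enn2real (RN_deriv M N \<omega>) - 1\<bar> \<partial>M)"

text \<open>
  The library's \<open>stopping_time\<close> forces the values of the stopping time into the index type of the
  filtration, here \<^typ>\<open>nat\<close>, which would exclude the value \<open>\<infinity>\<close>.
\<close>
definition ext_stopping_time :: "(nat \<Rightarrow> 'a measure) \<Rightarrow> ('a \<Rightarrow> enat) \<Rightarrow> bool" where
  "ext_stopping_time F \<tau> \<longleftrightarrow> (\<forall>t. Measurable.pred (F t) (\<lambda>\<omega>. \<tau> \<omega> \<le> enat t))"

definition stopped :: "(nat \<Rightarrow> 'a \<Rightarrow> 'b) \<Rightarrow> ('a \<Rightarrow> enat) \<Rightarrow> nat \<Rightarrow> 'a \<Rightarrow> 'b" where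
  "stopped X \<tau> t \<omega> = X (the_enat (min (enat t) (\<tau> \<omega>))) \<omega>"

text \<open>
  The conditional expectation of a vector is taken componentwise. Adaptedness is not a separate
  requirement: the almost sure equality makes each \<open>X t\<close> almost surely equal to an
  \<open>F t\<close>-measurable random variable.
\<close>
definition martingale ::
    "'a measure \<Rightarrow> (nat \<Rightarrow> 'a measure) \<Rightarrow> (nat \<Rightarrow> 'a \<Rightarrow> real ^ 'd) \<Rightarrow> bool" where
  "martingale R F X \<longleftrightarrow>
     (\<forall>t. integrable R (X t)) \<and>
     (\<forall>t i. AE \<omega> in R. real_cond_exp R (F t) (\<lambda>\<omega>. X (Suc t) \<omega> $ i) \<omega> = X t \<omega> $ i)"

definition local_martingale ::
    "'a measure \<Rightarrow> (nat \<Rightarrow> 'a measure) \<Rightarrow> (nat \<Rightarrow> 'a \<Rightarrow> real ^ 'd) \<Rightarrow> bool" where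
  "local_martingale R F X \<longleftrightarrow>
     (\<forall>t. X t \<in> borel_measurable R) \<and>
     (\<exists>\<tau> :: nat \<Rightarrow> 'a \<Rightarrow> enat.
        (\<forall>n. ext_stopping_time F (\<tau> n)) \<and>
        (AE \<omega> in R. (\<lambda>n. \<tau> n \<omega>) \<longlonglongrightarrow> \<infinity>) \<and>
        (\<forall>n. martingale R F (\<lambda>t \<omega>. indicator {\<omega>. \<tau> n \<omega> > 0} \<omega> *\<^sub>R stopped X (\<tau> n) t \<omega>)))"

end

theory Submission
  imports Defs
begin

text \<open>
  The measure \<open>Q\<close> is built from a density \<open>D\<close> with respect to \<open>P\<close>. Its martingale property amounts to
  \<open>E\<^sub>P[D \<xi>\<^sub>t (S\<^sub>t\<^sub>+\<^sub>1 - S\<^sub>t) | F\<^sub>t] = 0\<close> for all \<open>t\<close>, where \<open>\<xi>\<^sub>t > 0\<close> is an \<open>F\<^sub>t\<close>-measurable factor that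
  makes the increments of the local martingale integrable (\<open>local_martingale_increments\<close>). The
  moments are finite because \<open>D\<close> times the exponential of the size of \<open>S\<^sub>t\<close> is bounded.

  The heart is one period. Let \<open>F\<close> describe the past, and let a weight \<open>W\<close> and finitely many
  integrable variables \<open>X\<^sub>i\<close> be given. A factor \<open>0 < \<zeta> \<le> 1 + \<eta>\<close> is wanted for which \<open>\<zeta> W\<close> has an
  \<open>F\<close>-measurable bound, without change of the conditional expectations of \<open>1\<close> and of the \<open>X\<^sub>i\<close>. Lowering
  the density from \<open>1\<close> to \<open>1 / (1 + W)\<close> where \<open>W\<close> exceeds some level bounds \<open>\<zeta> W\<close>, but changes these
  conditional expectations. The change is undone by a bounded multiple of \<open>1 / (1 + W)\<close>, found by a
  conditional weighted \<open>L\<^sup>2\<close> projection onto the span of \<open>1\<close> and the \<open>X\<^sub>i\<close>, all divided by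
  \<open>1 + \<Sum>\<^sub>i \<bar>X\<^sub>i\<bar>\<close> so that they are bounded. The size of this correction is at most an \<open>F\<close>-measurable constant
  times the conditional \<open>L\<^sup>1\<close> size of the change, and this constant does not depend on the change
  (\<open>bounded_weighted_projection\<close>). A high enough \<open>F\<close>-measurable level therefore makes the correction
  as small as desired (\<open>ex_truncation_level\<close>, \<open>one_step_density\<close>).

  For a finite horizon one works backwards: the bound obtained for the last period is the weight for
  the period before, until it is a constant (\<open>finite_horizon_density\<close>).

  For the infinite horizon a sequence of densities \<open>D\<^sub>n\<close> is chosen, where \<open>D\<^sub>n\<^sub>+\<^sub>1\<close> arises from \<open>D\<^sub>n\<close> by the
  finite-horizon result under the measure with density \<open>D\<^sub>n\<close> and takes care of the weight at time \<open>n\<close>.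
  Since \<open>D\<^sub>n\<^sub>+\<^sub>1 \<le> (1 + \<eta>\<^sub>n) D\<^sub>n\<close> and both have mean one, they are \<open>2 \<eta>\<^sub>n\<close>-close in \<open>L\<^sup>1\<close>. The same
  inequalities make the sequence converge pointwise, and the limit is at most \<open>2 D\<^sub>n\<close>, so that what was
  bounded at some stage stays bounded. Each \<open>\<eta>\<^sub>n\<close> is chosen with knowledge of how likely small values
  of \<open>D\<^sub>n\<close> are, which keeps the limit almost surely positive (\<open>ex_equivalent_density\<close>).
\<close>

section \<open>Random variables with vanishing conditional expectation\<close>

text \<open>
  Integrability is part of the notion because \<open>real_cond_exp\<close> is total, so that it can vanish for
  functions without a conditional expectation.
\<close>
definition cond_null :: "'a measure \<Rightarrow> 'a measure \<Rightarrow> ('a \<Rightarrow> real) \<Rightarrow> bool" where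
  "cond_null M F f \<longleftrightarrow> integrable M f \<and> (AE x in M. real_cond_exp M F f x = 0)"

lemma cond_null_integrable: "cond_null M F f \<Longrightarrow> integrable M f"
  by (simp add: cond_null_def)

context sigma_finite_subalgebra
begin

lemma cond_nullI_cond_exp:
  assumes "integrable M f" "AE x in M. real_cond_exp M F f x = 0"
  shows "cond_null M F f"
  using assms by (simp add: cond_null_def)

lemma cond_nullI_sets:
  assumes "integrable M f" "\<And>A. A \<in> sets F \<Longrightarrow> (\<integral>x. indicator A x * f x \<partial>M) = 0"
  shows "cond_null M F f"
proof (rule cond_nullI_cond_exp)
  show "AE x in M. real_cond_exp M F f x = 0"
    by (rule real_cond_exp_charact) (use assms in \<open>simp_all add: set_lebesgue_integral_def\<close>)
qed fact

lemma cond_null_integral: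
  assumes f: "cond_null M F f" and [measurable]: "g \<in> borel_measurable F"
    and int: "integrable M (\<lambda>x. g x * f x)"
  shows "(\<integral>x. g x * f x \<partial>M) = 0"
proof -
  have [measurable]: "f \<in> borel_measurable M" "g \<in> borel_measurable M"
    using f measurable_from_subalg[OF subalg assms(2)] by (auto simp: cond_null_def)
  have "(\<integral>x. g x * f x \<partial>M) = (\<integral>x. g x * real_cond_exp M F f x \<partial>M)"
    by (rule real_cond_exp_intg(2)[symmetric]) (use int in auto)
  also have "\<dots> = (\<integral>x. 0 \<partial>M)"
    by (rule integral_cong_AE) (use f in \<open>auto simp: cond_null_def\<close>)
  finally show ?thesis by simp
qed

lemma cond_null_mult:
  assumes f: "cond_null M F f" and [measurable]: "g \<in> borel_measurable F"
    and int: "integrable M (\<lambda>x. g x * f x)"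
  shows "cond_null M F (\<lambda>x. g x * f x)"
proof -
  have [measurable]: "f \<in> borel_measurable M"
    using f by (auto simp: cond_null_def)
  have "AE x in M. real_cond_exp M F (\<lambda>x. g x * f x) x = g x * real_cond_exp M F f x"
    by (rule real_cond_exp_mult) (use int in auto)
  with f show ?thesis
    unfolding cond_null_def using int by auto
qed

lemma cond_null_add:
  assumes "cond_null M F f" "cond_null M F g"
  shows "cond_null M F (\<lambda>x. f x + g x)"
proof -
  have "AE x in M. real_cond_exp M F (\<lambda>x. f x + g x) x = real_cond_exp M F f x + real_cond_exp M F g x"
    by (rule real_cond_exp_add) (use assms in \<open>auto simp: cond_null_def\<close>)
  then show ?thesis using assms unfolding cond_null_def by auto
qed

lemma cond_null_diff:
  assumes "cond_null M F f" "cond_null M F g"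
  shows "cond_null M F (\<lambda>x. f x - g x)"
proof -
  have "AE x in M. real_cond_exp M F (\<lambda>x. f x - g x) x = real_cond_exp M F f x - real_cond_exp M F g x"
    by (rule real_cond_exp_diff) (use assms in \<open>auto simp: cond_null_def\<close>)
  moreover have "AE x in M. real_cond_exp M F f x = 0" "AE x in M. real_cond_exp M F g x = 0"
    using assms by (auto simp: cond_null_def)
  ultimately have "AE x in M. real_cond_exp M F (\<lambda>x. f x - g x) x = 0"
    by eventually_elim simp
  then show ?thesis using assms by (simp add: cond_null_def)
qed

lemma cond_null_cong_AE:
  assumes "cond_null M F f" "AE x in M. f x = g x" "g \<in> borel_measurable M"
  shows "cond_null M F g"
proof -
  have [measurable]: "f \<in> borel_measurable M" "g \<in> borel_measurable M"
    using assms by (auto simp: cond_null_def)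
  have "AE x in M. real_cond_exp M F f x = real_cond_exp M F g x"
    by (rule real_cond_exp_cong) (use assms in auto)
  moreover have "integrable M g"
    using integrable_cong_AE[of f M g] assms by (auto simp: cond_null_def)
  ultimately show ?thesis using assms(1) unfolding cond_null_def by auto
qed

lemma cond_null_coarser:
  assumes f: "cond_null M F f" and G: "subalgebra F G" "sigma_finite_subalgebra M G"
  shows "cond_null M G f"
proof (rule sigma_finite_subalgebra.cond_nullI_sets[OF G(2)])
  show int: "integrable M f" using f by (rule cond_null_integrable)
  fix A assume "A \<in> sets G"
  then have A[measurable]: "A \<in> sets F" using G by (auto simp: subalgebra_def)
  then have "A \<in> sets M" using subalg by (auto simp: subalgebra_def)
  then show "(\<integral>x. indicator A x * f x \<partial>M) = 0"
    by (intro cond_null_integral[OF f]) (use integrable_mult_indicator[OF _ int] in auto)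
qed

lemma cond_null_minus_cond_exp:
  assumes f: "integrable M f"
  shows "cond_null M F (\<lambda>x. f x - real_cond_exp M F f x)"
proof (rule cond_nullI_cond_exp)
  have i: "integrable M (real_cond_exp M F f)" using f by (rule real_cond_exp_int)
  then show "integrable M (\<lambda>x. f x - real_cond_exp M F f x)" using f by simp
  have "AE x in M. real_cond_exp M F (\<lambda>x. f x - real_cond_exp M F f x) x
      = real_cond_exp M F f x - real_cond_exp M F (real_cond_exp M F f) x"
    by (rule real_cond_exp_diff[OF f i])
  moreover have "AE x in M. real_cond_exp M F (real_cond_exp M F f) x = real_cond_exp M F f x"
    by (rule real_cond_exp_F_meas[OF i]) simp
  ultimately show "AE x in M. real_cond_exp M F (\<lambda>x. f x - real_cond_exp M F f x) x = 0"
    by eventually_elim simp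
qed

end

lemma integrable_mult_bounded:
  fixes f g :: "'a \<Rightarrow> real"
  assumes "integrable M f" "g \<in> borel_measurable M" "\<And>x. \<bar>g x\<bar> \<le> B"
  shows "integrable M (\<lambda>x. g x * f x)"
proof (rule Bochner_Integration.integrable_bound[of M "\<lambda>x. B * f x"])
  have "\<bar>g x\<bar> * \<bar>f x\<bar> \<le> B * \<bar>f x\<bar>" for x by (intro mult_right_mono assms) auto
  moreover have "B \<ge> 0" using assms(3)[of undefined] by linarith
  ultimately show "AE x in M. norm (g x * f x) \<le> norm (B * f x)" by (auto simp: abs_mult)
qed (use assms in auto)

lemma prob_space_density_real:
  fixes D :: "'a \<Rightarrow> real"
  assumes "integrable M D" "\<And>x. 0 \<le> D x" "(\<integral>x. D x \<partial>M) = 1"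
  shows "prob_space (density M D)"
proof (rule prob_spaceI)
  have "emeasure (density M D) (space M) = (\<integral>\<^sup>+x. ennreal (D x) \<partial>M)"
    using assms(1) by (subst emeasure_density) (auto cong: nn_integral_cong)
  then show "emeasure (density M D) (space (density M D)) = 1"
    using assms by (simp add: nn_integral_eq_integral)
qed

text \<open>
  Under a change of measure conditional expectations change by a normalising factor (Bayes' formula),
  but whether they vanish is decided by integrals over sets of the past, where the density simply
  moves into the integrand.
\<close>
lemma cond_null_density:
  fixes D f :: "'a \<Rightarrow> real"
  assumes M: "sigma_finite_subalgebra M F" "sigma_finite_subalgebra (density M D) F"
    and [measurable]: "D \<in> borel_measurable M" and D: "\<And>x. 0 \<le> D x" and f[measurable]: "f \<in> borel_measurable M"
  shows "cond_null (density M D) F f \<longleftrightarrow> cond_null M F (\<lambda>x. D x * f x)"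
proof -
  interpret M: sigma_finite_subalgebra M F by fact
  interpret N: sigma_finite_subalgebra "density M D" F by fact
  have A: "A \<in> sets M" if "A \<in> sets F" for A using that M.subalg by (auto simp: subalgebra_def)
  have int: "integrable (density M D) f \<longleftrightarrow> integrable M (\<lambda>x. D x * f x)"
    using D by (subst integrable_real_density) auto
  have swap: "(\<integral>x. indicator A x * f x \<partial>density M D) = (\<integral>x. indicator A x * (D x * f x) \<partial>M)"
    if "A \<in> sets F" for A
    using A[OF that] D by (subst integral_real_density) (auto simp: ac_simps)
  show ?thesis
  proof
    assume n: "cond_null (density M D) F f"
    show "cond_null M F (\<lambda>x. D x * f x)"
    proof (rule M.cond_nullI_sets)
      show "integrable M (\<lambda>x. D x * f x)" using cond_null_integrable[OF n] by (simp add: int)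
      fix A assume "A \<in> sets F"
      then show "(\<integral>x. indicator A x * (D x * f x) \<partial>M) = 0"
        using integrable_mult_indicator[OF _ cond_null_integrable[OF n], of A] A
        by (subst swap[symmetric]) (auto intro!: N.cond_null_integral[OF n])
    qed
  next
    assume n: "cond_null M F (\<lambda>x. D x * f x)"
    show "cond_null (density M D) F f"
    proof (rule N.cond_nullI_sets)
      show "integrable (density M D) f" using cond_null_integrable[OF n] by (simp add: int)
      fix A assume "A \<in> sets F"
      then show "(\<integral>x. indicator A x * f x \<partial>density M D) = 0"
        using integrable_mult_indicator[OF _ cond_null_integrable[OF n], of A] A
        by (subst swap) (auto intro!: M.cond_null_integral[OF n])
    qed
  qed
qed

section \<open>Bounded projections onto a conditional span\<close>

text \<open>
  This is the projection of \<open>e / \<phi>\<close> onto the span of \<open>A\<close> with \<open>F\<close>-measurable coefficients, for the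
  conditional inner product with weight \<open>\<phi>\<close>: the residual is orthogonal to \<open>A\<close>, and \<open>h\<close> lies in the
  span. The latter is expressed by duality, as orthogonality of \<open>h\<close> to everything that is orthogonal to
  \<open>A\<close>, which avoids coefficients.
\<close>
definition weighted_projection ::
  "'a measure \<Rightarrow> 'a measure \<Rightarrow> ('a \<Rightarrow> real) \<Rightarrow> ('a \<Rightarrow> real) set \<Rightarrow> ('a \<Rightarrow> real) \<Rightarrow> ('a \<Rightarrow> real) \<Rightarrow> bool"
  where
  "weighted_projection M F \<phi> A e h \<longleftrightarrow>
     (\<forall>U\<in>A. cond_null M F (\<lambda>x. (e x - \<phi> x * h x) * U x)) \<and>
     (\<forall>f. integrable M f \<longrightarrow> (\<forall>U\<in>A. cond_null M F (\<lambda>x. f x * U x)) \<longrightarrow>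
        cond_null M F (\<lambda>x. f x * h x))"

text \<open>
  One step of the conditional Gram-Schmidt procedure for each element of \<open>A\<close>. The part \<open>V\<close> of the new
  element that is orthogonal to the old ones is again obtained by a projection, after division by \<open>K\<close>
  to satisfy the smallness condition of the induction hypothesis. With \<open>q = E[\<phi> V\<^sup>2 | F]\<close> the new
  coefficient is \<open>b = E[e V | F] / q\<close>; it is small if \<open>E[\<bar>e\<bar> | F]\<close> is small compared with \<open>q\<close>, whence
  the term \<open>8 / q\<close> in the new constant. Where \<open>q = 0\<close> the new element already lies in the old span and
  its coefficient is set to zero; linear dependence may thus vary from point to point.

  It is essential that \<open>K\<close> is chosen before \<open>e\<close>.
\<close>
lemma (in finite_measure_subalgebra) bounded_weighted_projection:
  assumes H: "subalgebra M H" "subalgebra H F"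
    and \<phi>: "\<phi> \<in> borel_measurable H" "\<And>x. 0 < \<phi> x" "\<And>x. \<phi> x \<le> (1::real)"
    and A: "finite A" "A \<subseteq> {U \<in> borel_measurable H. \<forall>x. \<bar>U x\<bar> \<le> (1::real)}"
  shows "\<exists>K \<in> borel_measurable F. (\<forall>x. (1::real) \<le> K x) \<and>
    (\<forall>e \<in> borel_measurable H. integrable M e \<longrightarrow>
       (AE x in M. K x * real_cond_exp M F (\<lambda>x. \<bar>e x\<bar>) x \<le> 1) \<longrightarrow>
       (\<exists>h \<in> borel_measurable H. (AE x in M. \<bar>h x\<bar> \<le> 1) \<and> weighted_projection M F \<phi> A e h))"
  using A
proof (induction A rule: finite_induct)
  case empty
  have "cond_null M F (\<lambda>x. f x * 0)" for f
    by (rule cond_nullI_sets) auto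
  then show ?case
    by (intro bexI[of _ "\<lambda>x. 1"]) (auto simp: weighted_projection_def intro!: bexI[of _ "\<lambda>x. 0"])
next
  case (insert U A)
  have HM: "f \<in> borel_measurable M" if "f \<in> borel_measurable H" for f :: "'a \<Rightarrow> real"
    using measurable_from_subalg[OF H(1) that] .
  have FH: "f \<in> borel_measurable H" if "f \<in> borel_measurable F" for f :: "'a \<Rightarrow> real"
    using measurable_from_subalg[OF H(2) that] .
  have FM: "f \<in> borel_measurable M" if "f \<in> borel_measurable F" for f :: "'a \<Rightarrow> real"
    using HM FH that by blast
  have [measurable]: "U \<in> borel_measurable H" "\<phi> \<in> borel_measurable H"
    using insert.prems \<phi> by auto
  have [measurable]: "U \<in> borel_measurable M" "\<phi> \<in> borel_measurable M"
    by (auto intro: HM)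
  have U1: "\<bar>U x\<bar> \<le> 1" for x using insert.prems by auto
  have \<phi>1: "\<bar>\<phi> x\<bar> \<le> 1" for x using \<phi>(2,3)[of x] by auto
  obtain K where [measurable]: "K \<in> borel_measurable F" and K1: "\<And>x. 1 \<le> K x"
    and KIH: "\<And>e. e \<in> borel_measurable H \<Longrightarrow> integrable M e \<Longrightarrow>
         (AE x in M. K x * real_cond_exp M F (\<lambda>x. \<bar>e x\<bar>) x \<le> 1) \<Longrightarrow>
       \<exists>h \<in> borel_measurable H. (AE x in M. \<bar>h x\<bar> \<le> 1) \<and> weighted_projection M F \<phi> A e h"
    using insert.IH insert.prems by auto
  have [measurable]: "K \<in> borel_measurable H" "K \<in> borel_measurable M"
    by (auto intro: FH FM)
  have K0: "0 < K x" "K x \<noteq> 0" for x using K1[of x] by auto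
  define e0 where "e0 = (\<lambda>x. \<phi> x * U x / K x)"
  have e0m[measurable]: "e0 \<in> borel_measurable H" "e0 \<in> borel_measurable M"
    unfolding e0_def by measurable
  have e0b: "\<bar>e0 x\<bar> \<le> 1 / K x" for x
  proof -
    have "\<bar>\<phi> x * U x\<bar> \<le> 1 * 1" unfolding abs_mult by (intro mult_mono) (use U1 \<phi>1 in auto)
    then show ?thesis using K0[of x] by (simp add: e0_def abs_mult divide_right_mono abs_divide)
  qed
  have invK: "\<bar>1 / K x\<bar> \<le> 1" for x using K1[of x] by simp
  have intK: "integrable M (\<lambda>x. 1 / K x)"
    by (rule integrable_const_bound[of _ 1]) (use invK in auto)
  have int0: "integrable M e0"
    by (rule Bochner_Integration.integrable_bound[OF intK]) (use e0b K0 in \<open>auto simp: less_imp_le\<close>)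
  have "AE x in M. real_cond_exp M F (\<lambda>x. \<bar>e0 x\<bar>) x \<le> real_cond_exp M F (\<lambda>x. 1 / K x) x"
    by (rule real_cond_exp_mono) (use int0 intK e0b in auto)
  moreover have "AE x in M. real_cond_exp M F (\<lambda>x. 1 / K x) x = 1 / K x"
    by (rule real_cond_exp_F_meas) (use intK in auto)
  ultimately have "AE x in M. K x * real_cond_exp M F (\<lambda>x. \<bar>e0 x\<bar>) x \<le> 1"
  proof eventually_elim
    case (elim x)
    then have "real_cond_exp M F (\<lambda>x. \<bar>e0 x\<bar>) x \<le> 1 / K x" by simp
    then show ?case using K0[of x] by (simp add: field_simps)
  qed
  from KIH[OF _ int0 this] obtain h0 where [measurable]: "h0 \<in> borel_measurable H"
    and h0b: "AE x in M. \<bar>h0 x\<bar> \<le> 1"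
    and h0o: "\<And>U. U \<in> A \<Longrightarrow> cond_null M F (\<lambda>x. (e0 x - \<phi> x * h0 x) * U x)"
    and h0s: "\<And>f. integrable M f \<Longrightarrow> (\<And>U. U \<in> A \<Longrightarrow> cond_null M F (\<lambda>x. f x * U x)) \<Longrightarrow>
             cond_null M F (\<lambda>x. f x * h0 x)"
    using e0m(1) unfolding weighted_projection_def by blast
  have [measurable]: "h0 \<in> borel_measurable M" by (auto intro: HM)
  define V where "V = (\<lambda>x. U x / K x - h0 x)"
  have Vm[measurable]: "V \<in> borel_measurable H" "V \<in> borel_measurable M"
    unfolding V_def by measurable
  have Vb: "AE x in M. \<bar>V x\<bar> \<le> 2"
    using h0b
  proof eventually_elim
    case (elim x)
    have "\<bar>U x / K x\<bar> \<le> 1" using U1[of x] K1[of x] by (auto simp: abs_divide intro: order_trans)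
    with elim show ?case unfolding V_def by linarith
  qed
  define q where "q = real_cond_exp M F (\<lambda>x. \<phi> x * (V x)\<^sup>2)"
  have [measurable]: "q \<in> borel_measurable F" unfolding q_def by simp
  have [measurable]: "q \<in> borel_measurable H" "q \<in> borel_measurable M"
    by (auto intro: FH FM)
  have V2b: "AE x in M. \<bar>\<phi> x * (V x)\<^sup>2\<bar> \<le> 4"
    using Vb
  proof eventually_elim
    case (elim x)
    have "(V x)\<^sup>2 \<le> 2\<^sup>2" using elim by (metis abs_le_square_iff abs_numeral)
    then have "\<phi> x * (V x)\<^sup>2 \<le> 1 * 4" by (intro mult_mono) (use \<phi>(2,3)[of x] in auto)
    then show ?case using \<phi>(2)[of x] by (simp add: abs_mult)
  qed
  have intV2: "integrable M (\<lambda>x. \<phi> x * (V x)\<^sup>2)"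
    by (rule integrable_const_bound[of _ 4]) (use V2b in auto)
  have q0: "AE x in M. 0 \<le> q x"
    unfolding q_def by (rule real_cond_exp_pos) (use \<phi> in \<open>auto simp: less_imp_le\<close>)
  \<comment> \<open>the set where \<open>q\<close> vanishes belongs to the past, so the integral of \<open>\<phi> V\<^sup>2\<close> over it is that of \<open>q\<close>\<close>
  have V0: "AE x in M. q x \<le> 0 \<longrightarrow> V x = 0"
  proof -
    let ?B = "\<lambda>x. if q x \<le> 0 then 1 else 0 :: real"
    have [measurable]: "?B \<in> borel_measurable F" by measurable
    then have [measurable]: "?B \<in> borel_measurable M" by (rule FM)
    have i: "integrable M (\<lambda>x. ?B x * (\<phi> x * (V x)\<^sup>2))"
      by (rule Bochner_Integration.integrable_bound[OF intV2]) auto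
    have "(\<integral>x. ?B x * (\<phi> x * (V x)\<^sup>2) \<partial>M) = (\<integral>x. ?B x * q x \<partial>M)"
      unfolding q_def by (rule real_cond_exp_intg(2)[symmetric]) (use i in \<open>auto simp: q_def\<close>)
    also have "\<dots> = (\<integral>x. 0 \<partial>M)"
      by (rule integral_cong_AE) (use q0 in auto)
    finally have "(\<integral>x. ?B x * (\<phi> x * (V x)\<^sup>2) \<partial>M) = 0" by simp
    then have "AE x in M. ?B x * (\<phi> x * (V x)\<^sup>2) = 0"
      by (subst (asm) integral_nonneg_eq_0_iff_AE[OF i]) (use \<phi> in \<open>auto simp: less_imp_le\<close>)
    then show ?thesis
    proof eventually_elim
      case (elim x)
      then show ?case using \<phi>(2)[of x] by (auto split: if_splits)
    qed
  qed
  define K' where "K' = (\<lambda>x. 2 * K x + (if q x > 0 then 8 / q x else 0))"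
  have [measurable]: "K' \<in> borel_measurable F" unfolding K'_def by measurable
  have K'2: "2 * K x \<le> K' x" "q x > 0 \<Longrightarrow> 8 / q x \<le> K' x" for x
    using K0[of x] by (auto simp: K'_def)
  have K'1: "1 \<le> K' x" for x using K'2(1)[of x] K1[of x] by auto
  show ?case
  proof (rule bexI[of _ K'], intro conjI allI impI ballI)
    show "1 \<le> K' x" for x by (rule K'1)
    show "K' \<in> borel_measurable F" by fact
    fix e assume [measurable]: "e \<in> borel_measurable H" and inte: "integrable M e"
      and eb: "AE x in M. K' x * real_cond_exp M F (\<lambda>x. \<bar>e x\<bar>) x \<le> 1"
    have [measurable]: "e \<in> borel_measurable M" by (auto intro: HM)
    have e2: "(\<lambda>x. 2 * e x) \<in> borel_measurable H" "integrable M (\<lambda>x. 2 * e x)"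
      using inte by auto
    have e0: "AE x in M. 0 \<le> real_cond_exp M F (\<lambda>x. \<bar>e x\<bar>) x"
      by (rule real_cond_exp_pos) auto
    have "AE x in M. real_cond_exp M F (\<lambda>x. 2 * \<bar>e x\<bar>) x = 2 * real_cond_exp M F (\<lambda>x. \<bar>e x\<bar>) x"
      by (rule real_cond_exp_cmult) (use inte in auto)
    with eb e0 have "AE x in M. K x * real_cond_exp M F (\<lambda>x. \<bar>2 * e x\<bar>) x \<le> 1"
    proof eventually_elim
      case (elim x)
      have "2 * K x * real_cond_exp M F (\<lambda>x. \<bar>e x\<bar>) x \<le> K' x * real_cond_exp M F (\<lambda>x. \<bar>e x\<bar>) x"
        by (intro mult_right_mono K'2 elim)
      with elim show ?case by (simp add: abs_mult)
    qed
    from KIH[OF e2 this] obtain h' where [measurable]: "h' \<in> borel_measurable H"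
      and h'b: "AE x in M. \<bar>h' x\<bar> \<le> 1"
      and h'o: "\<And>U. U \<in> A \<Longrightarrow> cond_null M F (\<lambda>x. (2 * e x - \<phi> x * h' x) * U x)"
      and h's: "\<And>f. integrable M f \<Longrightarrow> (\<And>U. U \<in> A \<Longrightarrow> cond_null M F (\<lambda>x. f x * U x)) \<Longrightarrow>
             cond_null M F (\<lambda>x. f x * h' x)"
      unfolding weighted_projection_def by blast
    have [measurable]: "h' \<in> borel_measurable M" by (auto intro: HM)
    have half: "cond_null M F (\<lambda>x. f x / 2)" if "cond_null M F f" for f
      using cond_null_mult[OF that, of "\<lambda>_. 1/2"] cond_null_integrable[OF that] by simp
    \<comment> \<open>doubling \<open>e\<close> for the projection on the old span leaves half of the range \<open>[-1, 1]\<close> to the new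
      direction\<close>
    define h1 where "h1 = (\<lambda>x. h' x / 2)"
    have h1m[measurable]: "h1 \<in> borel_measurable H" "h1 \<in> borel_measurable M" by (simp_all add: h1_def)
    have h1b: "AE x in M. \<bar>h1 x\<bar> \<le> 1/2" using h'b by (auto simp: h1_def)
    have h1o: "cond_null M F (\<lambda>x. (e x - \<phi> x * h1 x) * W x)" if "W \<in> A" for W
      using half[OF h'o[OF that]] by (simp add: h1_def field_simps)
    have h1s: "cond_null M F (\<lambda>x. f x * h1 x)"
      if "integrable M f" "\<And>U. U \<in> A \<Longrightarrow> cond_null M F (\<lambda>x. f x * U x)" for f
      using half[OF h's[OF that]] by (simp add: h1_def)
    have eV: "AE x in M. \<bar>e x * V x\<bar> \<le> 2 * \<bar>e x\<bar>"
      using Vb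
    proof eventually_elim
      case (elim x)
      then show ?case using mult_right_mono[OF elim, of "\<bar>e x\<bar>"] by (simp add: abs_mult mult.commute)
    qed
    have inteV: "integrable M (\<lambda>x. e x * V x)"
      by (rule Bochner_Integration.integrable_bound[of M "\<lambda>x. 2 * e x"])
        (use eV inte in \<open>auto simp: abs_mult\<close>)
    define g where "g = real_cond_exp M F (\<lambda>x. e x * V x)"
    have [measurable]: "g \<in> borel_measurable F" by (simp add: g_def)
    define b where "b = (\<lambda>x. if q x > 0 then g x / q x else 0)"
    have [measurable]: "b \<in> borel_measurable F" unfolding b_def by measurable
    then have [measurable]: "b \<in> borel_measurable H" "b \<in> borel_measurable M"
      by (auto intro: FH FM)
    have gb: "AE x in M. \<bar>g x\<bar> \<le> 2 * real_cond_exp M F (\<lambda>x. \<bar>e x\<bar>) x"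
    proof -
      have i2: "integrable M (\<lambda>x. 2 * \<bar>e x\<bar>)" using inte by simp
      have le: "AE x in M. e x * V x \<le> 2 * \<bar>e x\<bar>" "AE x in M. (-2) * \<bar>e x\<bar> \<le> e x * V x"
        using eV by (eventually_elim, linarith)+
      have "AE x in M. real_cond_exp M F (\<lambda>x. e x * V x) x \<le> real_cond_exp M F (\<lambda>x. 2 * \<bar>e x\<bar>) x"
        by (rule real_cond_exp_mono) (use le i2 inteV in auto)
      moreover have "AE x in M. real_cond_exp M F (\<lambda>x. (-2) * \<bar>e x\<bar>) x \<le> real_cond_exp M F (\<lambda>x. e x * V x) x"
        by (rule real_cond_exp_mono) (use le i2 inte inteV in auto)
      moreover have "AE x in M. real_cond_exp M F (\<lambda>x. 2 * \<bar>e x\<bar>) x = 2 * real_cond_exp M F (\<lambda>x. \<bar>e x\<bar>) x"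
        by (rule real_cond_exp_cmult) (use inte in auto)
      moreover have "AE x in M. real_cond_exp M F (\<lambda>x. (-2) * \<bar>e x\<bar>) x = (-2) * real_cond_exp M F (\<lambda>x. \<bar>e x\<bar>) x"
        by (rule real_cond_exp_cmult) (use inte in auto)
      ultimately show ?thesis
        by eventually_elim (auto simp: g_def)
    qed
    have bV: "AE x in M. \<bar>b x * V x\<bar> \<le> 1/2"
      using gb Vb eb e0
    proof eventually_elim
      case (elim x)
      show ?case
      proof (cases "q x > 0")
        case True
        have "8 / q x * real_cond_exp M F (\<lambda>x. \<bar>e x\<bar>) x \<le> K' x * real_cond_exp M F (\<lambda>x. \<bar>e x\<bar>) x"
          using True elim by (intro mult_right_mono K'2) auto
        then have "8 / q x * real_cond_exp M F (\<lambda>x. \<bar>e x\<bar>) x \<le> 1" using elim by linarith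
        then have "real_cond_exp M F (\<lambda>x. \<bar>e x\<bar>) x \<le> q x / 8"
          using True by (simp add: field_simps)
        with elim have "\<bar>g x\<bar> \<le> q x / 4" by linarith
        then have "\<bar>b x\<bar> \<le> 1/4" using True by (simp add: b_def abs_divide field_simps)
        then have "\<bar>b x\<bar> * \<bar>V x\<bar> \<le> 1/4 * 2" by (intro mult_mono) (use elim in auto)
        then show ?thesis by (simp add: abs_mult)
      qed (simp add: b_def)
    qed
    define h where "h = (\<lambda>x. h1 x + b x * V x)"
    have [measurable]: "h \<in> borel_measurable H" "h \<in> borel_measurable M" unfolding h_def by measurable
    have hb: "AE x in M. \<bar>h x\<bar> \<le> 1"
      using h1b bV by eventually_elim (auto simp: h_def)
    have int_bd: "integrable M (\<lambda>x. f x * w x)"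
      if "integrable M f" "AE x in M. \<bar>w x\<bar> \<le> 1" "w \<in> borel_measurable M" for f w :: "'a \<Rightarrow> real"
    proof (rule Bochner_Integration.integrable_bound[OF that(1)])
      show "AE x in M. norm (f x * w x) \<le> norm (f x)"
        using that(2) by eventually_elim (auto simp: abs_mult mult_left_le)
    qed (use that in measurable)
    have intb: "integrable M f" if "AE x in M. \<bar>f x\<bar> \<le> c" "f \<in> borel_measurable M" for f :: "'a \<Rightarrow> real" and c :: real
      by (rule integrable_const_bound[of _ c]) (use that in auto)
    have \<phi>V: "integrable M (\<lambda>x. \<phi> x * V x)"
    proof (rule intb[of _ 2])
      show "AE x in M. \<bar>\<phi> x * V x\<bar> \<le> 2" using Vb
      proof eventually_elim
        case (elim x)
        have "\<bar>\<phi> x\<bar> * \<bar>V x\<bar> \<le> 1 * 2" by (intro mult_mono) (use elim \<phi>1 in auto)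
        then show ?case by (simp add: abs_mult)
      qed
    qed simp
    have \<phi>h: "integrable M (\<lambda>x. \<phi> x * h x)"
      by (rule int_bd[OF intb[of \<phi> 1] hb]) (use \<phi>1 in auto)
    have r: "integrable M (\<lambda>x. e x - \<phi> x * h x)" using inte \<phi>h by simp
    have bhalf: "AE x in M. \<bar>b x * V x\<bar> \<le> 1" "AE x in M. \<bar>h1 x\<bar> \<le> 1"
      using bV h1b by (eventually_elim, linarith)+
    have \<phi>VW: "cond_null M F (\<lambda>x. \<phi> x * V x * W x)" if "W \<in> A" for W
      using h0o[OF that] by (simp add: e0_def V_def field_simps)
    have oldU: "cond_null M F (\<lambda>x. (e x - \<phi> x * h x) * W x)" if W: "W \<in> A" for W
    proof -
      have [measurable]: "W \<in> borel_measurable M" using insert.prems W by (auto intro: HM)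
      have W1: "AE x in M. \<bar>W x\<bar> \<le> 1" using insert.prems W by auto
      have "integrable M (\<lambda>x. (\<phi> x * (b x * V x)) * W x)"
        by (rule int_bd[OF int_bd[OF intb[of \<phi> 1] bhalf(1)] W1]) (use \<phi>1 in auto)
      then have "cond_null M F (\<lambda>x. b x * (\<phi> x * V x * W x))"
        by (intro cond_null_mult[OF \<phi>VW[OF W]]) (auto simp: ac_simps)
      from cond_null_diff[OF h1o[OF W] this] show ?thesis
        by (simp add: h_def algebra_simps)
    qed
    \<comment> \<open>the contribution of \<open>h1\<close> vanishes because \<open>\<phi> V\<close> is orthogonal to the old span, and \<open>b\<close> is made to
      cancel the rest\<close>
    have rV: "cond_null M F (\<lambda>x. (e x - \<phi> x * h x) * V x)"
    proof -
      have i3: "integrable M (\<lambda>x. b x * (\<phi> x * (V x)\<^sup>2))"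
      proof -
        have "integrable M (\<lambda>x. \<phi> x * V x * (b x * V x))"
          by (rule int_bd[OF \<phi>V bhalf(1)]) auto
        then show ?thesis by (simp add: ac_simps power2_eq_square)
      qed
      have "cond_null M F (\<lambda>x. e x * V x - b x * (\<phi> x * (V x)\<^sup>2))"
      proof -
        let ?B = "\<lambda>x. if q x > 0 then 1 else 0 :: real"
        have [measurable]: "?B \<in> borel_measurable F" by measurable
        then have [measurable]: "?B \<in> borel_measurable M" by (rule FM)
        have i4: "integrable M (\<lambda>x. e x * V x - b x * (\<phi> x * (V x)\<^sup>2))" using inteV i3 by simp
        have i5: "integrable M (\<lambda>x. ?B x * (e x * V x - b x * (\<phi> x * (V x)\<^sup>2)))"
          by (rule Bochner_Integration.integrable_bound[OF i4]) auto
        have "AE x in M. real_cond_exp M F (\<lambda>x. ?B x * (e x * V x - b x * (\<phi> x * (V x)\<^sup>2))) x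
            = ?B x * real_cond_exp M F (\<lambda>x. e x * V x - b x * (\<phi> x * (V x)\<^sup>2)) x"
          by (rule real_cond_exp_mult) (use i5 in auto)
        moreover have "AE x in M. real_cond_exp M F (\<lambda>x. e x * V x - b x * (\<phi> x * (V x)\<^sup>2)) x
            = g x - real_cond_exp M F (\<lambda>x. b x * (\<phi> x * (V x)\<^sup>2)) x"
          unfolding g_def by (rule real_cond_exp_diff) (use inteV i3 in auto)
        moreover have "AE x in M. real_cond_exp M F (\<lambda>x. b x * (\<phi> x * (V x)\<^sup>2)) x = b x * q x"
          unfolding q_def by (rule real_cond_exp_mult) (use i3 in auto)
        ultimately have "AE x in M. real_cond_exp M F (\<lambda>x. ?B x * (e x * V x - b x * (\<phi> x * (V x)\<^sup>2))) x = 0"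
          by eventually_elim (auto simp: b_def)
        then have "cond_null M F (\<lambda>x. ?B x * (e x * V x - b x * (\<phi> x * (V x)\<^sup>2)))"
          using i5 by (intro cond_nullI_cond_exp)
        then show ?thesis
        proof (rule cond_null_cong_AE)
          show "AE x in M. ?B x * (e x * V x - b x * (\<phi> x * (V x)\<^sup>2)) = e x * V x - b x * (\<phi> x * (V x)\<^sup>2)"
            using V0 by eventually_elim auto
        qed simp
      qed
      from cond_null_diff[OF this h1s[OF \<phi>V \<phi>VW]] show ?thesis
        by (simp add: h_def algebra_simps power2_eq_square)
    qed
    \<comment> \<open>\<open>h0\<close> lies in the old span, to which the residual is orthogonal; together with \<open>V\<close> it makes up \<open>U / K\<close>\<close>
    have rh0: "cond_null M F (\<lambda>x. (e x - \<phi> x * h x) * h0 x)"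
      by (rule h0s[OF r oldU])
    have newU: "cond_null M F (\<lambda>x. (e x - \<phi> x * h x) * U x)"
    proof -
      have "cond_null M F (\<lambda>x. (e x - \<phi> x * h x) * V x + (e x - \<phi> x * h x) * h0 x)"
        by (rule cond_null_add[OF rV rh0])
      then have "cond_null M F (\<lambda>x. (e x - \<phi> x * h x) * U x / K x)"
        by (simp add: V_def algebra_simps diff_divide_distrib)
      then have "cond_null M F (\<lambda>x. K x * ((e x - \<phi> x * h x) * U x / K x))"
        by (rule cond_null_mult) (use int_bd[OF r, of U] U1 K0 in \<open>auto simp: AE_I2\<close>)
      then show ?thesis using K0 by simp
    qed
    have "weighted_projection M F \<phi> (insert U A) e h"
      unfolding weighted_projection_def
    proof (intro conjI allI impI)
      fix f assume intf: "integrable M f" and *: "\<forall>U\<in>insert U A. cond_null M F (\<lambda>x. f x * U x)"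
      then have fA: "\<And>U. U \<in> A \<Longrightarrow> cond_null M F (\<lambda>x. f x * U x)"
        and fU: "cond_null M F (\<lambda>x. f x * U x)" by auto
      have [measurable]: "f \<in> borel_measurable M" using intf by auto
      have "cond_null M F (\<lambda>x. (1 / K x) * (f x * U x))"
      proof (rule cond_null_mult[OF fU])
        have "integrable M (\<lambda>x. (f x * U x) * (1 / K x))"
          by (rule int_bd[OF int_bd[OF intf]]) (use U1 invK in \<open>simp_all del: abs_divide\<close>)
        then show "integrable M (\<lambda>x. (1 / K x) * (f x * U x))" by (simp add: ac_simps)
      qed simp
      from cond_null_diff[OF this h0s[OF intf fA]]
      have fV: "cond_null M F (\<lambda>x. f x * V x)" by (simp add: V_def algebra_simps)
      have "integrable M (\<lambda>x. f x * (b x * V x))"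
        by (rule int_bd[OF intf bhalf(1)]) auto
      then have "cond_null M F (\<lambda>x. b x * (f x * V x))"
        by (intro cond_null_mult[OF fV]) (auto simp: ac_simps)
      from cond_null_add[OF h1s[OF intf fA] this]
      show "cond_null M F (\<lambda>x. f x * h x)" by (simp add: h_def algebra_simps)
    qed (use oldU newU in auto)
    with hb show "\<exists>h \<in> borel_measurable H. (AE x in M. \<bar>h x\<bar> \<le> 1) \<and>
        weighted_projection M F \<phi> (insert U A) e h" by auto
  qed
qed

section \<open>Density factors for one period\<close>

text \<open>
  Conditional expectations of \<open>R\<close> over \<open>{W > k}\<close> tend to \<open>0\<close> as \<open>k\<close> grows, so the least admissible level
  exists almost surely. This is seen by integrating over the event \<open>I\<close> where no level is admissible,
  which needs dominated convergence for integrals only.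
\<close>
lemma (in finite_measure_subalgebra) ex_truncation_level:
  fixes R W c :: "'a \<Rightarrow> real"
  assumes R: "integrable M R" "\<And>x. 0 \<le> R x" and [measurable]: "W \<in> borel_measurable M"
    and [measurable]: "c \<in> borel_measurable F" and c: "\<And>x. 0 < c x" "\<And>x. c x \<le> 1"
  shows "\<exists>\<kappa> \<in> measurable F (count_space (UNIV :: nat set)).
    AE x in M. real_cond_exp M F (\<lambda>x. if real (\<kappa> x) < W x then R x else 0) x \<le> c x"
proof -
  have FM: "f \<in> borel_measurable M" if "f \<in> borel_measurable F" for f :: "'a \<Rightarrow> real"
    using measurable_from_subalg[OF subalg that] .
  have [measurable]: "R \<in> borel_measurable M" using R by auto
  have cM[measurable]: "c \<in> borel_measurable M" by (rule FM) fact
  define r where "r = (\<lambda>k x. if real k < W x then R x else 0)"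
  have [measurable]: "r k \<in> borel_measurable M" for k unfolding r_def by measurable
  define m where "m = (\<lambda>k. real_cond_exp M F (r k))"
  have [measurable]: "m k \<in> borel_measurable F" "m k \<in> borel_measurable M" for k by (simp_all add: m_def)
  define I where "I = (\<lambda>x. if \<forall>k. c x < m k x then 1 else 0 :: real)"
  have I_F[measurable]: "I \<in> borel_measurable F" unfolding I_def by measurable
  have [measurable]: "I \<in> borel_measurable M" by (rule FM) fact
  have intIc: "integrable M (\<lambda>x. I x * c x)"
    by (rule integrable_const_bound[of _ 1]) (use c in \<open>auto simp: I_def less_imp_le\<close>)
  have intIr: "integrable M (\<lambda>x. I x * r k x)" for k
    by (rule Bochner_Integration.integrable_bound[OF R(1)]) (use R(2) in \<open>auto simp: I_def r_def\<close>)
  have Im: "(\<integral>x. I x * c x \<partial>M) \<le> (\<integral>x. I x * r k x \<partial>M)" for k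
  proof -
    have "(\<integral>x. I x * c x \<partial>M) \<le> (\<integral>x. I x * m k x \<partial>M)"
    proof (rule integral_mono)
      show "integrable M (\<lambda>x. I x * m k x)"
        unfolding m_def by (rule real_cond_exp_intg(1)) (use intIr in auto)
      show "I x * c x \<le> I x * m k x" for x
        by (auto simp: I_def intro: less_imp_le)
    qed fact
    also have "\<dots> = (\<integral>x. I x * r k x \<partial>M)"
      unfolding m_def by (rule real_cond_exp_intg(2)) (use intIr in auto)
    finally show ?thesis .
  qed
  have "(\<lambda>k. \<integral>x. I x * r k x \<partial>M) \<longlonglongrightarrow> (\<integral>x. 0 \<partial>M)"
  proof (rule integral_dominated_convergence[where w = R])
    show "AE x in M. (\<lambda>k. I x * r k x) \<longlonglongrightarrow> 0"
    proof (rule AE_I2)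
      fix x
      obtain n where n: "W x \<le> real n" using real_arch_simple by blast
      have "eventually (\<lambda>k. I x * r k x = 0) sequentially"
        using eventually_ge_at_top[of n] by eventually_elim (use n in \<open>auto simp: r_def\<close>)
      then show "(\<lambda>k. I x * r k x) \<longlonglongrightarrow> 0" by (rule tendsto_eventually)
    qed
  qed (use R in \<open>auto simp: I_def r_def\<close>)
  then have "(\<lambda>k. \<integral>x. I x * r k x \<partial>M) \<longlonglongrightarrow> 0" by simp
  then have "(\<integral>x. I x * c x \<partial>M) \<le> 0"
    by (rule tendsto_lowerbound) (use Im in auto)
  then have "(\<integral>x. I x * c x \<partial>M) = 0"
    using c by (intro antisym integral_nonneg_AE) (auto simp: I_def less_imp_le)
  then have "AE x in M. I x * c x = 0"
    by (subst (asm) integral_nonneg_eq_0_iff_AE[OF intIc]) (use c in \<open>auto simp: I_def less_imp_le\<close>)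
  then have ex: "AE x in M. \<exists>k. m k x \<le> c x"
  proof eventually_elim
    case (elim x)
    then show ?case using c(1)[of x] by (auto simp: I_def not_less split: if_splits)
  qed
  define \<kappa> where "\<kappa> = (\<lambda>x. LEAST k. m k x \<le> c x)"
  have \<kappa>_F[measurable]: "\<kappa> \<in> measurable F (count_space UNIV)" unfolding \<kappa>_def by measurable
  have [measurable]: "\<kappa> \<in> measurable M (count_space UNIV)"
    by (rule measurable_from_subalg[OF subalg \<kappa>_F])
  let ?r = "\<lambda>x. if real (\<kappa> x) < W x then R x else 0"
  \<comment> \<open>a statement about fixed levels extends to the random level \<open>\<kappa>\<close> since \<open>\<kappa>\<close> is \<open>F\<close>-measurable with
    countably many values\<close>
  have "AE x in M. (if \<kappa> x = k then 1 else 0) * real_cond_exp M F ?r x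
      = (if \<kappa> x = k then 1 else 0) * m k x" for k
  proof -
    let ?J = "\<lambda>x. if \<kappa> x = k then 1 else 0 :: real"
    have [measurable]: "?J \<in> borel_measurable F" by measurable
    have i: "integrable M (\<lambda>x. ?J x * ?r x)" "integrable M (\<lambda>x. ?J x * r k x)"
      by (rule Bochner_Integration.integrable_bound[OF R(1)]; use R(2) in \<open>auto simp: r_def\<close>)+
    have eq: "(\<lambda>x. ?J x * ?r x) = (\<lambda>x. ?J x * r k x)" by (auto simp: r_def)
    have "AE x in M. real_cond_exp M F (\<lambda>x. ?J x * ?r x) x = ?J x * real_cond_exp M F ?r x"
      by (rule real_cond_exp_mult) (use i in auto)
    moreover have "AE x in M. real_cond_exp M F (\<lambda>x. ?J x * r k x) x = ?J x * m k x"
      unfolding m_def by (rule real_cond_exp_mult) (use i in auto)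
    ultimately show ?thesis unfolding eq by eventually_elim auto
  qed
  then have "AE x in M. \<forall>k. (if \<kappa> x = k then 1 else 0) * real_cond_exp M F ?r x
      = (if \<kappa> x = k then 1 else 0) * m k x"
    by (simp add: AE_all_countable)
  then have "AE x in M. real_cond_exp M F ?r x \<le> c x"
    using ex
  proof eventually_elim
    case (elim x)
    have "m (\<kappa> x) x \<le> c x" unfolding \<kappa>_def using elim(2) by (rule LeastI_ex)
    then show ?case using elim(1)[rule_format, of "\<kappa> x"] by simp
  qed
  then show ?thesis using \<kappa>_F by blast
qed

text \<open>
  Here \<open>u\<close> is the mass removed where \<open>W\<close> is large, and the last summand of \<open>\<zeta>\<close> is the correction. The
  projection carries the weight \<open>\<phi> = 1 / (1 + W)\<close> because the correction must not exceed what is left of the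
  density, which is at least \<open>\<phi>\<close>: this keeps \<open>\<zeta>\<close> positive, and it also keeps \<open>\<zeta> W\<close> bounded.
\<close>
lemma (in finite_measure_subalgebra) one_step_density:
  fixes X :: "'i::finite \<Rightarrow> 'a \<Rightarrow> real"
  assumes H: "subalgebra M H" "subalgebra H F"
    and X: "\<And>i. X i \<in> borel_measurable H" "\<And>i. integrable M (X i)"
    and W: "W \<in> borel_measurable H" "\<And>x. 0 \<le> W x"
    and \<eta>: "0 < \<eta>" "\<eta> < 1"
  shows "\<exists>\<zeta> \<in> borel_measurable H. \<exists>V \<in> borel_measurable F.
    (\<forall>x. 0 < \<zeta> x \<and> \<zeta> x \<le> 1 + \<eta> \<and> 0 \<le> V x \<and> \<zeta> x * W x \<le> V x) \<and>
    cond_null M F (\<lambda>x. \<zeta> x - 1) \<and> (\<forall>i. cond_null M F (\<lambda>x. (\<zeta> x - 1) * X i x))"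
proof -
  have HM: "f \<in> borel_measurable M" if "f \<in> borel_measurable H" for f :: "'a \<Rightarrow> real"
    using measurable_from_subalg[OF H(1) that] .
  note [measurable] = X(1) W(1)
  have [measurable]: "W \<in> borel_measurable M" "X i \<in> borel_measurable M" for i by (auto intro: HM)
  define R where "R = (\<lambda>x. 1 + (\<Sum>i\<in>UNIV. \<bar>X i x\<bar>))"
  have R1: "1 \<le> R x" for x unfolding R_def by (simp add: sum_nonneg)
  then have R0: "0 < R x" "R x \<noteq> 0" for x using less_le_trans[OF zero_less_one] by (metis, metis not_one_le_zero)
  have XR: "\<bar>X i x\<bar> \<le> R x" for i x
    using member_le_sum[of i UNIV "\<lambda>i. \<bar>X i x\<bar>"] by (simp add: R_def)
  have [measurable]: "R \<in> borel_measurable H" unfolding R_def by measurable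
  have [measurable]: "R \<in> borel_measurable M" by (auto intro: HM)
  have R_int: "integrable M R" unfolding R_def using X(2) by auto
  define \<phi> where "\<phi> = (\<lambda>x. 1 / (1 + W x))"
  have \<phi>: "0 < \<phi> x" "\<phi> x \<le> 1" for x using W(2)[of x] by (auto simp: \<phi>_def)
  have \<phi>_H[measurable]: "\<phi> \<in> borel_measurable H" unfolding \<phi>_def by measurable
  have [measurable]: "\<phi> \<in> borel_measurable M" by (auto intro: HM)
  define A where "A = insert (\<lambda>x. 1 / R x) (range (\<lambda>i x. X i x / R x))"
  have A: "finite A" "A \<subseteq> {U \<in> borel_measurable H. \<forall>x. \<bar>U x\<bar> \<le> 1}"
    using XR R1 R0 by (auto simp: A_def abs_divide less_imp_le)
  obtain K where [measurable]: "K \<in> borel_measurable F" and K1: "\<And>x. 1 \<le> K x"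
    and K: "\<And>e. e \<in> borel_measurable H \<Longrightarrow> integrable M e \<Longrightarrow>
       (AE x in M. K x * real_cond_exp M F (\<lambda>x. \<bar>e x\<bar>) x \<le> 1) \<Longrightarrow>
       \<exists>h \<in> borel_measurable H. (AE x in M. \<bar>h x\<bar> \<le> 1) \<and> weighted_projection M F \<phi> A e h"
    using bounded_weighted_projection[OF H \<phi>_H \<phi> A] by blast
  have K0: "0 < K x" for x using less_le_trans[OF zero_less_one K1] .
  obtain \<kappa> where \<kappa>_F[measurable]: "\<kappa> \<in> measurable F (count_space (UNIV :: nat set))"
    and \<kappa>: "AE x in M. real_cond_exp M F (\<lambda>x. if real (\<kappa> x) < W x then R x else 0) x \<le> \<eta> / K x"
  proof -
    have "0 < \<eta> / K x" "\<eta> / K x \<le> 1" for x using K1[of x] K0[of x] \<eta> by (auto simp: field_simps)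
    then show thesis
      using ex_truncation_level[OF R_int, of W "\<lambda>x. \<eta> / K x"] R0 that by (auto simp: less_imp_le)
  qed
  have \<kappa>_H[measurable]: "\<kappa> \<in> measurable H (count_space UNIV)"
    by (rule measurable_from_subalg[OF H(2) \<kappa>_F])
  have [measurable]: "\<kappa> \<in> measurable M (count_space UNIV)"
    by (rule measurable_from_subalg[OF H(1) \<kappa>_H])
  define u where "u = (\<lambda>x. if real (\<kappa> x) < W x then 1 - \<phi> x else 0)"
  have u: "0 \<le> u x" "u x \<le> 1 - \<phi> x" "u x \<le> 1" for x using \<phi>[of x] by (auto simp: u_def)
  have [measurable]: "u \<in> borel_measurable H" unfolding u_def by measurable
  have [measurable]: "u \<in> borel_measurable M" by (auto intro: HM)
  have uR_int: "integrable M (\<lambda>x. u x * R x)"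
    by (rule Bochner_Integration.integrable_bound[OF R_int])
      (use u R0 in \<open>auto simp: abs_mult mult_left_le_one_le\<close>)
  define e where "e = (\<lambda>x. u x * R x / \<eta>)"
  have [measurable]: "e \<in> borel_measurable H" unfolding e_def by measurable
  have e_int: "integrable M e" unfolding e_def using uR_int by simp
  have "AE x in M. K x * real_cond_exp M F (\<lambda>x. \<bar>e x\<bar>) x \<le> 1"
  proof -
    let ?r = "\<lambda>x. if real (\<kappa> x) < W x then R x else 0"
    have r_int: "integrable M ?r"
      by (rule Bochner_Integration.integrable_bound[OF R_int]) (use R0 in auto)
    have "\<bar>e x\<bar> \<le> ?r x / \<eta>" for x
    proof -
      have "u x * R x \<le> ?r x"
        using \<phi>[of x] R0[of x] by (auto simp: u_def mult_le_cancel_right1)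
      then show ?thesis using u(1)[of x] R0(1)[of x] \<eta> by (simp add: e_def abs_mult abs_divide divide_right_mono)
    qed
    then have "AE x in M. real_cond_exp M F (\<lambda>x. \<bar>e x\<bar>) x \<le> real_cond_exp M F (\<lambda>x. ?r x / \<eta>) x"
      by (intro real_cond_exp_mono AE_I2) (use e_int r_int in auto)
    moreover have "AE x in M. real_cond_exp M F (\<lambda>x. ?r x / \<eta>) x = real_cond_exp M F ?r x / \<eta>"
      by (rule real_cond_exp_cdiv[OF r_int])
    ultimately show ?thesis using \<kappa>
    proof eventually_elim
      case (elim x)
      then have "real_cond_exp M F ?r x / \<eta> \<le> \<eta> / K x / \<eta>"
        using \<eta> by (intro divide_right_mono) auto
      then have "real_cond_exp M F (\<lambda>x. \<bar>e x\<bar>) x \<le> 1 / K x" using elim \<eta> by simp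
      then show ?case using K0[of x] by (simp add: field_simps)
    qed
  qed
  from K[OF _ e_int this] obtain h' where [measurable]: "h' \<in> borel_measurable H"
    and h'1: "AE x in M. \<bar>h' x\<bar> \<le> 1"
    and h': "\<And>U. U \<in> A \<Longrightarrow> cond_null M F (\<lambda>x. (e x - \<phi> x * h' x) * U x)"
    unfolding weighted_projection_def by auto
  \<comment> \<open>clipping turns the almost sure bound into one that holds everywhere\<close>
  define h where "h = (\<lambda>x. max (-1) (min 1 (h' x)))"
  have [measurable]: "h \<in> borel_measurable H" unfolding h_def by measurable
  have [measurable]: "h \<in> borel_measurable M" "e \<in> borel_measurable M" by (auto intro: HM)
  have h1: "\<bar>h x\<bar> \<le> 1" for x by (auto simp: h_def)
  have h: "cond_null M F (\<lambda>x. (e x - \<phi> x * h x) * U x)" if "U \<in> A" for U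
  proof (rule cond_null_cong_AE[OF h'[OF that]])
    show "AE x in M. (e x - \<phi> x * h' x) * U x = (e x - \<phi> x * h x) * U x"
      using h'1 by eventually_elim (auto simp: h_def)
    have [measurable]: "U \<in> borel_measurable M" using that A by (auto intro: HM)
    show "(\<lambda>x. (e x - \<phi> x * h x) * U x) \<in> borel_measurable M" by measurable
  qed
  define \<zeta> where "\<zeta> = (\<lambda>x. 1 - u x + \<eta> * (h x * \<phi> x / R x))"
  have corr: "\<bar>h x * \<phi> x / R x\<bar> \<le> \<phi> x" for x
  proof -
    have "\<bar>h x\<bar> * \<phi> x \<le> 1 * \<phi> x" by (intro mult_right_mono h1) (use \<phi> in \<open>simp add: less_imp_le\<close>)
    also have "\<dots> \<le> \<phi> x * R x" using R1[of x] \<phi>[of x] by simp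
    finally show ?thesis
      using R0[of x] \<phi>[of x] by (simp add: abs_mult abs_divide field_simps)
  qed
  have eqn: "(\<lambda>x. (- \<eta>) * ((e x - \<phi> x * h x) * (Y x / R x))) = (\<lambda>x. (\<zeta> x - 1) * Y x)" for Y
    using R0 \<eta> by (auto simp: \<zeta>_def e_def field_simps fun_eq_iff)
  have null: "cond_null M F (\<lambda>x. (\<zeta> x - 1) * Y x)" if "(\<lambda>x. Y x / R x) \<in> A" for Y
  proof -
    have "cond_null M F (\<lambda>x. (- \<eta>) * ((e x - \<phi> x * h x) * (Y x / R x)))"
      by (rule cond_null_mult[OF h[OF that]])
        (simp, rule integrable_mult_right, rule cond_null_integrable[OF h[OF that]])
    then show ?thesis unfolding eqn .
  qed
  show ?thesis
  proof (rule bexI[of _ \<zeta>], rule bexI[of _ "\<lambda>x. real (\<kappa> x) + 2"], intro conjI allI)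
    fix x
    have c: "\<bar>\<eta> * (h x * \<phi> x / R x)\<bar> \<le> \<eta> * \<phi> x"
      using mult_left_mono[OF corr, of \<eta>] \<eta> by (simp add: abs_mult)
    have "\<eta> * \<phi> x < \<phi> x" using \<eta> \<phi>[of x] by simp
    with c u(2)[of x] show "0 < \<zeta> x" unfolding \<zeta>_def by linarith
    have "\<eta> * \<phi> x \<le> \<eta>" using \<eta> \<phi>[of x] by simp
    with c u(1)[of x] show "\<zeta> x \<le> 1 + \<eta>" unfolding \<zeta>_def by linarith
    have \<phi>W: "\<phi> x * W x \<le> 1" using W(2)[of x] by (simp add: \<phi>_def)
    have "\<zeta> x \<le> 1 - u x + \<phi> x" using c \<open>\<eta> * \<phi> x < \<phi> x\<close> unfolding \<zeta>_def by linarith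
    then have "\<zeta> x * W x \<le> (1 - u x + \<phi> x) * W x" using W by (intro mult_right_mono) auto
    also have "\<dots> = (1 - u x) * W x + \<phi> x * W x" by (simp add: algebra_simps)
    also have "\<dots> \<le> (real (\<kappa> x) + 1) + 1"
      using \<phi>W by (intro add_mono) (auto simp: u_def)
    finally show "\<zeta> x * W x \<le> real (\<kappa> x) + 2" by simp
  next
    show "cond_null M F (\<lambda>x. \<zeta> x - 1)"
      using null[of "\<lambda>_. 1"] by (simp add: A_def)
    show "cond_null M F (\<lambda>x. (\<zeta> x - 1) * X i x)" for i
      by (rule null) (auto simp: A_def)
    show "\<zeta> \<in> borel_measurable H" unfolding \<zeta>_def by measurable
  qed auto
qed

section \<open>Finite horizon\<close>

lemma borel_measurable_trivial_const:
  assumes f: "f \<in> borel_measurable (sigma \<Omega> {})" and x: "x \<in> \<Omega>" "y \<in> \<Omega>"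
  shows "f x = (f y :: real)"
proof -
  have "f -` {f y} \<inter> \<Omega> \<in> sigma_sets \<Omega> {}"
    using measurable_sets[OF f, of "{f y}"] by (simp add: space_measure_of_conv)
  then show ?thesis using x by (auto simp: sigma_sets_empty_eq)
qed

text \<open>
  Backward induction: the factor \<open>\<zeta>\<close> for the period from \<open>N\<close> to \<open>N + 1\<close> turns the weight \<open>W\<close> into an
  \<open>F\<^sub>N\<close>-measurable weight \<open>V\<close>, to which the induction hypothesis applies with a factor \<open>\<rho>\<close>. In the product
  \<open>\<rho> \<zeta>\<close> the increment at time \<open>N\<close> is taken care of by \<open>\<zeta>\<close>, earlier ones by \<open>\<rho>\<close> since \<open>\<zeta>\<close> has
  conditional mean one, and later ones keep conditional mean zero because \<open>\<rho> \<zeta>\<close> belongs to their past. At time \<open>0\<close> one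
  more such step, from the trivial \<open>\<sigma>\<close>-algebra, makes the bound a constant.
\<close>
lemma (in prob_space) finite_horizon_density:
  fixes X :: "nat \<Rightarrow> 'i::finite \<Rightarrow> 'a \<Rightarrow> real"
  assumes F: "\<And>t. subalgebra M (F t)" "\<And>s t. s \<le> t \<Longrightarrow> subalgebra (F t) (F s)"
    and X: "\<And>t i. X t i \<in> borel_measurable (F (Suc t))" "\<And>t i. cond_null M (F t) (X t i)"
    and W: "W \<in> borel_measurable (F N)" "\<And>x. 0 \<le> W x" and \<eta>: "0 < \<eta>" "\<eta> < 1"
  shows "\<exists>\<rho> \<in> borel_measurable (F N). \<exists>C. (\<forall>x. 0 < \<rho> x \<and> \<rho> x \<le> 1 + \<eta>) \<and>
    (\<forall>x \<in> space M. \<rho> x * W x \<le> C) \<and> expectation \<rho> = 1 \<and>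
    (\<forall>t i. cond_null M (F t) (\<lambda>x. \<rho> x * X t i x))"
  using W \<eta>
proof (induction N arbitrary: W \<eta>)
  case 0
  define G where "G = sigma (space M) {}"
  have "subalgebra M G" and G0: "subalgebra (F 0) G"
    using F(1)[of 0] sets.top[of "F 0"] by (auto simp: G_def subalgebra_def sigma_sets_empty_eq)
  interpret G: finite_measure_subalgebra M G by standard fact
  interpret F0: finite_measure_subalgebra M "F t" for t by standard (rule F)
  have zero: "(\<lambda>_. 0) \<in> borel_measurable (F 0)" "integrable M (\<lambda>_. 0)" for i :: unit by simp_all
  obtain \<zeta> V where [measurable]: "\<zeta> \<in> borel_measurable (F 0)" "V \<in> borel_measurable G"
    and \<zeta>: "\<And>x. 0 < \<zeta> x" "\<And>x. \<zeta> x \<le> 1 + \<eta>" "\<And>x. \<zeta> x * W x \<le> V x"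
    and null: "cond_null M G (\<lambda>x. \<zeta> x - 1)"
    using G.one_step_density[OF F(1) G0 zero "0"] by blast
  have [measurable]: "\<zeta> \<in> borel_measurable M"
    by (rule measurable_from_subalg[OF F(1)[of 0]]) simp
  have \<zeta>_int: "integrable M \<zeta>"
    by (rule integrable_const_bound[of _ "1 + \<eta>"]) (use \<zeta> in \<open>auto simp: less_imp_le\<close>)
  obtain x0 where x0: "x0 \<in> space M" using not_empty by blast
  show ?case
  proof (intro bexI[of _ \<zeta>] exI[of _ "V x0"] conjI allI ballI)
    fix x assume "x \<in> space M"
    then have "V x = V x0"
      using borel_measurable_trivial_const[of V "space M" x x0] x0 by (simp add: G_def[symmetric])
    then show "\<zeta> x * W x \<le> V x0" using \<zeta>(3)[of x] by simp
  next
    have "(\<integral>x. 1 * (\<zeta> x - 1) \<partial>M) = 0"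
      by (rule G.cond_null_integral[OF null]) (use \<zeta>_int in auto)
    then show "expectation \<zeta> = 1" using \<zeta>_int by (simp add: prob_space)
  next
    fix t i
    have [measurable]: "\<zeta> \<in> borel_measurable (F t)"
      by (rule measurable_from_subalg[OF F(2)[of 0]]) auto
    show "cond_null M (F t) (\<lambda>x. \<zeta> x * X t i x)"
      by (rule F0.cond_null_mult[OF X(2)])
        (use \<zeta> in \<open>auto intro!: integrable_mult_bounded[where B = "1 + \<eta>"] cond_null_integrable[OF X(2)] simp: less_imp_le\<close>)
  qed (use \<zeta> in auto)
next
  case (Suc N)
  interpret FF: finite_measure_subalgebra M "F t" for t by standard (rule F)
  have Fm: "f \<in> borel_measurable (F t)" if "f \<in> borel_measurable (F s)" "s \<le> t" for f :: "'a \<Rightarrow> real" and s t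
    using measurable_from_subalg[OF F(2)[OF that(2)] that(1)] .
  have FM: "f \<in> borel_measurable M" if "f \<in> borel_measurable (F s)" for f :: "'a \<Rightarrow> real" and s
    using measurable_from_subalg[OF F(1) that] .
  have X_int: "integrable M (X t i)" for t i using X(2) by (rule cond_null_integrable)
  \<comment> \<open>small enough for \<open>(1 + \<theta>)\<^sup>2 \<le> 1 + \<eta>\<close>\<close>
  define \<theta> where "\<theta> = \<eta> / 3"
  have \<theta>: "0 < \<theta>" "\<theta> < 1" using Suc.prems by (auto simp: \<theta>_def)
  obtain \<zeta> V where \<zeta>_F[measurable]: "\<zeta> \<in> borel_measurable (F (Suc N))" and V: "V \<in> borel_measurable (F N)" "\<And>x. 0 \<le> V x"
    and \<zeta>: "\<And>x. 0 < \<zeta> x" "\<And>x. \<zeta> x \<le> 1 + \<theta>" "\<And>x. \<zeta> x * W x \<le> V x"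
    and null: "cond_null M (F N) (\<lambda>x. \<zeta> x - 1)" "\<And>i. cond_null M (F N) (\<lambda>x. (\<zeta> x - 1) * X N i x)"
    using FF.one_step_density[where X = "X N", OF F(1) F(2)[OF le_SucI[OF order_refl]] X(1)[of N] X_int[of N] Suc.prems(1,2) \<theta>]
    by blast
  obtain \<rho> C where \<rho>_F[measurable]: "\<rho> \<in> borel_measurable (F N)"
    and \<rho>: "\<And>x. 0 < \<rho> x" "\<And>x. \<rho> x \<le> 1 + \<theta>" "\<And>x. x \<in> space M \<Longrightarrow> \<rho> x * V x \<le> C"
    and \<rho>1: "expectation \<rho> = 1" and \<rho>X: "\<And>t i. cond_null M (F t) (\<lambda>x. \<rho> x * X t i x)"
    using Suc.IH[OF V \<theta>] by blast
  have [measurable]: "\<rho> \<in> borel_measurable M" "\<zeta> \<in> borel_measurable M"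
    by (rule FM[OF \<rho>_F], rule FM[OF \<zeta>_F])
  have \<rho>_int: "integrable M \<rho>"
    by (rule integrable_const_bound[of _ "1 + \<theta>"]) (use \<rho> in \<open>auto simp: less_imp_le\<close>)
  have abs_\<rho>: "\<bar>\<rho> x\<bar> \<le> 1 + \<theta>" for x using \<rho>(1,2)[of x] by simp
  have abs_\<zeta>: "\<bar>\<zeta> x - 1\<bar> \<le> 1" for x using \<zeta>(1,2)[of x] \<theta> by simp
  have le: "\<rho> x * \<zeta> x \<le> 1 + \<eta>" for x
  proof -
    have "\<rho> x * \<zeta> x \<le> (1 + \<theta>) * (1 + \<theta>)"
      by (intro mult_mono) (use \<rho>(1,2)[of x] \<zeta>(1,2)[of x] in \<open>auto simp: less_imp_le\<close>)
    also have "\<dots> \<le> 1 + 3 * \<theta>" using \<theta> by (simp add: algebra_simps)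
    finally show ?thesis by (simp add: \<theta>_def)
  qed
  have pos: "0 < \<rho> x * \<zeta> x" for x using \<rho>(1)[of x] \<zeta>(1)[of x] by simp
  have abs_\<rho>\<zeta>: "\<bar>\<rho> x * \<zeta> x\<bar> \<le> 1 + \<eta>" for x using le[of x] pos[of x] by simp
  have diff: "integrable M (\<lambda>x. \<rho> x * (\<zeta> x - 1))"
    by (rule integrable_mult_bounded[where B = "1 + \<theta>"])
      (use abs_\<rho> cond_null_integrable[OF null(1)] in auto)
  show ?case
  proof (intro bexI[of _ "\<lambda>x. \<rho> x * \<zeta> x"] exI[of _ C] conjI allI ballI)
    fix x assume x: "x \<in> space M"
    have "\<rho> x * \<zeta> x * W x \<le> \<rho> x * V x"
      using mult_left_mono[OF \<zeta>(3)[of x], of "\<rho> x"] \<rho>(1)[of x] by (simp add: mult.assoc)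
    also have "\<dots> \<le> C" by (rule \<rho>) fact
    finally show "\<rho> x * \<zeta> x * W x \<le> C" .
  next
    have "(\<integral>x. \<rho> x * (\<zeta> x - 1) \<partial>M) = 0"
      by (rule FF.cond_null_integral[OF null(1)]) (use diff in auto)
    moreover have "(\<lambda>x. \<rho> x * \<zeta> x) = (\<lambda>x. \<rho> x * (\<zeta> x - 1) + \<rho> x)" by (simp add: algebra_simps)
    ultimately show "expectation (\<lambda>x. \<rho> x * \<zeta> x) = 1"
      using diff \<rho>_int \<rho>1 by simp
  next
    fix t i
    consider "t < N" | "t = N" | "N < t" by linarith
    then show "cond_null M (F t) (\<lambda>x. \<rho> x * \<zeta> x * X t i x)"
    proof cases
      case 1
      then have [measurable]: "X t i \<in> borel_measurable (F N)" by (intro Fm[OF X(1)]) simp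
      have "integrable M (\<lambda>x. \<rho> x * ((\<zeta> x - 1) * X t i x))"
        by (intro integrable_mult_bounded[OF integrable_mult_bounded[OF X_int]])
          (use abs_\<rho> abs_\<zeta> in auto)
      then have "cond_null M (F N) (\<lambda>x. (\<rho> x * X t i x) * (\<zeta> x - 1))"
        by (intro FF.cond_null_mult[OF null(1)]) (auto simp: ac_simps)
      then have "cond_null M (F t) (\<lambda>x. (\<rho> x * X t i x) * (\<zeta> x - 1))"
        by (rule FF.cond_null_coarser) (use 1 F FF.sigma_finite_subalgebra_axioms in auto)
      from FF.cond_null_add[OF this \<rho>X[of t i]] show ?thesis by (simp add: algebra_simps)
    next
      case 2
      have \<zeta>X: "cond_null M (F N) (\<lambda>x. \<zeta> x * X N i x)"
        using FF.cond_null_add[OF null(2)[of i] X(2)[of N i]] by (simp add: algebra_simps)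
      have "cond_null M (F N) (\<lambda>x. \<rho> x * (\<zeta> x * X N i x))"
        by (intro FF.cond_null_mult[OF \<zeta>X] integrable_mult_bounded[OF cond_null_integrable[OF \<zeta>X]])
          (use abs_\<rho> in auto)
      then show ?thesis using 2 by (simp add: mult.assoc)
    next
      case 3
      have "\<rho> \<in> borel_measurable (F t)" "\<zeta> \<in> borel_measurable (F t)"
        using 3 Fm[OF \<rho>_F, of t] Fm[OF \<zeta>_F, of t] by auto
      then show ?thesis
        by (intro FF.cond_null_mult[OF X(2)] integrable_mult_bounded[OF X_int])
          (use abs_\<rho>\<zeta> in auto)
    qed
  next
    have "\<rho> \<in> borel_measurable (F (Suc N))" using Fm[OF \<rho>_F, of "Suc N"] by auto
    then show "(\<lambda>x. \<rho> x * \<zeta> x) \<in> borel_measurable (F (Suc N))" by measurable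
  qed (use pos le in auto)
qed

section \<open>Infinite horizon\<close>

definition martingale_density ::
  "'a measure \<Rightarrow> (nat \<Rightarrow> 'a measure) \<Rightarrow> (nat \<Rightarrow> 'i \<Rightarrow> 'a \<Rightarrow> real) \<Rightarrow> nat \<Rightarrow> ('a \<Rightarrow> real) \<Rightarrow> bool" where
  "martingale_density M F X n D \<longleftrightarrow>
     D \<in> borel_measurable (F n) \<and> (\<forall>x. 0 < D x) \<and> (\<exists>C. \<forall>x. D x \<le> C) \<and> (\<integral>x. D x \<partial>M) = 1 \<and>
     (\<forall>t i. cond_null M (F t) (\<lambda>x. D x * X t i x))"

text \<open>
  The finite-horizon factor is taken under the measure with density \<open>D\<close>, so that the new density is
  dominated by \<open>(1 + \<eta>) D\<close> and not merely by \<open>1 + \<eta>\<close>.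
\<close>
lemma (in prob_space) martingale_density_refine:
  fixes X :: "nat \<Rightarrow> 'i::finite \<Rightarrow> 'a \<Rightarrow> real"
  assumes F: "\<And>t. subalgebra M (F t)" "\<And>s t. s \<le> t \<Longrightarrow> subalgebra (F t) (F s)"
    and X: "\<And>t i. X t i \<in> borel_measurable (F (Suc t))"
    and D: "martingale_density M F X n D"
    and W: "W \<in> borel_measurable (F (Suc n))" "\<And>x. 0 \<le> W x" and \<eta>: "0 < \<eta>" "\<eta> < 1"
  shows "\<exists>D'. martingale_density M F X (Suc n) D' \<and> (\<forall>x. D' x \<le> (1 + \<eta>) * D x) \<and>
    (\<exists>C. \<forall>x \<in> space M. D' x * W x \<le> C)"
proof -
  interpret FF: finite_measure_subalgebra M "F t" for t by standard (rule F)
  have D_F: "D \<in> borel_measurable (F n)" and D0: "\<And>x. 0 < D x" and D1: "expectation D = 1"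
    and DX: "\<And>t i. cond_null M (F t) (\<lambda>x. D x * X t i x)"
    using D by (auto simp: martingale_density_def)
  obtain C where C: "\<And>x. D x \<le> C" using D by (auto simp: martingale_density_def)
  have FM: "f \<in> borel_measurable M" if "f \<in> borel_measurable (F s)" for f :: "'a \<Rightarrow> real" and s
    using measurable_from_subalg[OF F(1) that] .
  have [measurable]: "D \<in> borel_measurable M" "X t i \<in> borel_measurable M" for t i
    by (rule FM[OF D_F], rule FM[OF X])
  have D_int: "integrable M D" using D1 not_integrable_integral_eq by fastforce
  define P where "P = density M D"
  have P: "sets P = sets M" "space P = space M" by (auto simp: P_def)
  have integral_P: "(\<integral>x. f x \<partial>P) = (\<integral>x. D x * f x \<partial>M)"
    if "f \<in> borel_measurable M" for f :: "'a \<Rightarrow> real"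
    unfolding P_def using that D0 by (subst integral_real_density) (auto simp: less_imp_le)
  interpret P: prob_space P
    unfolding P_def using D_int D0 D1 by (intro prob_space_density_real) (auto simp: less_imp_le)
  have FP: "subalgebra P (F t)" for t using F(1)[of t] by (simp add: P subalgebra_def)
  interpret PP: finite_measure_subalgebra P "F t" for t by standard (rule FP)
  have null_P: "cond_null P (F t) f \<longleftrightarrow> cond_null M (F t) (\<lambda>x. D x * f x)"
    if "f \<in> borel_measurable M" for f t
    using cond_null_density[OF FF.sigma_finite_subalgebra_axioms PP.sigma_finite_subalgebra_axioms[unfolded P_def]]
      that D0 by (auto simp: P_def less_imp_le)
  have XP: "cond_null P (F t) (X t i)" for t i using DX by (simp add: null_P)
  obtain \<rho> B where \<rho>_F: "\<rho> \<in> borel_measurable (F (Suc n))"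
    and \<rho>: "\<And>x. 0 < \<rho> x" "\<And>x. \<rho> x \<le> 1 + \<eta>" "\<And>x. x \<in> space M \<Longrightarrow> \<rho> x * W x \<le> B"
    and \<rho>1: "P.expectation \<rho> = 1" and \<rho>X: "\<And>t i. cond_null P (F t) (\<lambda>x. \<rho> x * X t i x)"
    using P.finite_horizon_density[of F X W "Suc n" \<eta>, OF FP F(2) X XP W \<eta>] P by blast
  have [measurable]: "\<rho> \<in> borel_measurable M" by (rule FM[OF \<rho>_F])
  have C0: "0 < C" using D0[of undefined] C[of undefined] by linarith
  show ?thesis
  proof (intro exI[of _ "\<lambda>x. D x * \<rho> x"] conjI allI)
    show "D x * \<rho> x \<le> (1 + \<eta>) * D x" for x
      using mult_left_mono[OF \<rho>(2)[of x], of "D x"] D0[of x] by (simp add: mult.commute)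
    show "\<exists>C. \<forall>x\<in>space M. D x * \<rho> x * W x \<le> C"
    proof (intro exI[of _ "C * \<bar>B\<bar>"] ballI)
      fix x assume "x \<in> space M"
      then have "D x * (\<rho> x * W x) \<le> D x * \<bar>B\<bar>"
        using \<rho>(3)[of x] D0[of x] by (intro mult_left_mono) auto
      also have "\<dots> \<le> C * \<bar>B\<bar>" by (intro mult_right_mono C) simp
      finally show "D x * \<rho> x * W x \<le> C * \<bar>B\<bar>" by (simp add: mult.assoc)
    qed
    show "martingale_density M F X (Suc n) (\<lambda>x. D x * \<rho> x)"
      unfolding martingale_density_def
    proof (intro conjI allI)
      have "D \<in> borel_measurable (F (Suc n))"
        using measurable_from_subalg[OF F(2) D_F, of "Suc n"] by simp
      with \<rho>_F show "(\<lambda>x. D x * \<rho> x) \<in> borel_measurable (F (Suc n))" by measurable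
      have "D x * \<rho> x \<le> C * (1 + \<eta>)" for x
        using C[of x] D0[of x] \<rho>(1,2)[of x] C0 by (intro mult_mono) auto
      then show "\<exists>C. \<forall>x. D x * \<rho> x \<le> C" by blast
      show "expectation (\<lambda>x. D x * \<rho> x) = 1" using \<rho>1 by (simp add: integral_P)
      show "cond_null M (F t) (\<lambda>x. D x * \<rho> x * X t i x)" for t i
        using \<rho>X[of t i] by (simp add: null_P mult.assoc)
    qed (use D0 \<rho> in auto)
  qed
qed

lemma (in prob_space) ex_small_lower_level:
  fixes D :: "'a \<Rightarrow> real"
  assumes [measurable]: "D \<in> borel_measurable M" and D: "\<And>x. 0 < D x" and c: "0 < c" and \<delta>: "0 < \<delta>"
  shows "\<exists>c'. 0 < c' \<and> c' \<le> c \<and> prob {x \<in> space M. D x \<le> c'} \<le> \<delta>"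
proof -
  define A where "A = (\<lambda>k::nat. {x \<in> space M. D x \<le> c / real (Suc k)})"
  have "(\<lambda>k. prob (A k)) \<longlonglongrightarrow> prob (\<Inter>k. A k)"
  proof (rule finite_Lim_measure_decseq)
    show "range A \<subseteq> events" unfolding A_def by auto
    show "decseq A"
    proof (rule decseq_SucI)
      fix n
      have "c / real (Suc (Suc n)) \<le> c / real (Suc n)" using c by (intro divide_left_mono) auto
      then show "A (Suc n) \<subseteq> A n" unfolding A_def by auto
    qed
  qed
  moreover have "(\<Inter>k. A k) = {}"
  proof (rule equals0I)
    fix x assume x: "x \<in> (\<Inter>k. A k)"
    obtain n where n: "c / D x < real n" using reals_Archimedean2 by blast
    have "D x \<le> c / real (Suc n)" using x by (auto simp: A_def)
    then have "D x * real (Suc n) \<le> c" by (simp add: field_simps)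
    moreover have "c < D x * real n" using n D[of x] by (simp add: field_simps)
    moreover have "D x * real n \<le> D x * real (Suc n)" using D[of x] by (intro mult_left_mono) auto
    ultimately show False by linarith
  qed
  ultimately have "(\<lambda>k. prob (A k)) \<longlonglongrightarrow> 0" by simp
  from order_tendstoD(2)[OF this \<delta>] obtain k where "prob (A k) < \<delta>"
    by (auto simp: eventually_sequentially)
  then show ?thesis
    using c by (intro exI[of _ "c / real (Suc k)"]) (auto simp: A_def field_simps)
qed

text \<open>
  The densities are chosen together with levels \<open>c\<^sub>n\<close> such that \<open>D\<^sub>n \<le> c\<^sub>n\<close> has probability at most \<open>2\<^sup>-\<^sup>n\<close>,
  and \<open>\<eta>\<^sub>n\<close> is proportional to \<open>c\<^sub>n 2\<^sup>-\<^sup>n\<close>. The \<open>L\<^sup>1\<close> distance from \<open>D\<^sub>n\<close> to the limit \<open>E\<close> is then at most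
  \<open>c\<^sub>n 2\<^sup>-\<^sup>n\<close>, and Markov's inequality shows that \<open>E\<close> vanishes with probability at most \<open>2 \<cdot> 2\<^sup>-\<^sup>n\<close>, for
  every \<open>n\<close>. Pointwise convergence comes from monotonicity: dividing \<open>D\<^sub>n\<close> by \<open>a\<^sub>n = 2 - 2\<^sup>-\<^sup>n\<close> absorbs the
  factors \<open>1 + \<eta>\<^sub>n\<close> and leaves a decreasing sequence.
\<close>
lemma (in prob_space) ex_equivalent_density:
  fixes X :: "nat \<Rightarrow> 'i::finite \<Rightarrow> 'a \<Rightarrow> real"
  assumes F: "\<And>t. subalgebra M (F t)" "\<And>s t. s \<le> t \<Longrightarrow> subalgebra (F t) (F s)"
    and X: "\<And>t i. X t i \<in> borel_measurable (F (Suc t))" "\<And>t i. cond_null M (F t) (X t i)"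
    and W: "\<And>n. W n \<in> borel_measurable (F (Suc n))" "\<And>n x. 0 \<le> W n x" and \<epsilon>: "0 < \<epsilon>" "\<epsilon> < 1"
  shows "\<exists>D \<in> borel_measurable M. (\<forall>x. 0 \<le> D x) \<and> (AE x in M. 0 < D x) \<and>
    expectation D = 1 \<and> expectation (\<lambda>x. \<bar>D x - 1\<bar>) < \<epsilon> \<and>
    (\<forall>t i. cond_null M (F t) (\<lambda>x. D x * X t i x)) \<and> (\<forall>n. \<exists>C. \<forall>x \<in> space M. D x * W n x \<le> C)"
proof -
  interpret FF: finite_measure_subalgebra M "F t" for t by standard (rule F)
  have FM: "f \<in> borel_measurable M" if "f \<in> borel_measurable (F s)" for f :: "'a \<Rightarrow> real" and s
    using measurable_from_subalg[OF F(1) that] .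
  define \<eta> where "\<eta> = (\<lambda>(n::nat) c::real. \<epsilon> * c * (1/2)^n / 8)"
  let ?P = "\<lambda>n g. martingale_density M F X n (fst g) \<and> 0 < snd g \<and> snd g \<le> 1 \<and>
    prob {x \<in> space M. fst g x \<le> snd g} \<le> (1/2)^n \<and> (n = 0 \<longrightarrow> g = (\<lambda>_. 1, 1))"
  let ?Q = "\<lambda>n g g'. (\<forall>x. fst g' x \<le> (1 + \<eta> n (snd g)) * fst g x) \<and>
    snd g' \<le> snd g \<and> (\<exists>C. \<forall>x \<in> space M. fst g' x * W n x \<le> C)"
  have "\<exists>f. \<forall>n. ?P n (f n) \<and> ?Q n (f n) (f (Suc n))"
  proof (rule dependent_nat_choice)
    have "martingale_density M F X 0 (\<lambda>_. 1)" using X by (auto simp: martingale_density_def prob_space)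
    then show "\<exists>g. ?P 0 g" by (intro exI[of _ "(\<lambda>_. 1, 1)"]) auto
  next
    fix g n assume "?P n g"
    then have D: "martingale_density M F X n (fst g)" and c: "0 < snd g" "snd g \<le> 1" by auto
    have "\<epsilon> * snd g * (1/2)^n \<le> 1 * 1 * 1"
      using c \<epsilon> by (intro mult_mono) (auto simp: power_le_one)
    then have \<eta>: "0 < \<eta> n (snd g)" "\<eta> n (snd g) < 1" using c \<epsilon> by (auto simp: \<eta>_def)
    obtain D' where D': "martingale_density M F X (Suc n) D'" "\<forall>x. D' x \<le> (1 + \<eta> n (snd g)) * fst g x"
      "\<exists>C. \<forall>x \<in> space M. D' x * W n x \<le> C"
      using martingale_density_refine[OF F X(1) D W \<eta>] by blast
    then have D'_F: "D' \<in> borel_measurable (F (Suc n))" and D'0: "0 < D' x" for x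
      by (auto simp: martingale_density_def)
    have half: "(0::real) < (1/2)^Suc n" by simp
    obtain c' where "0 < c'" "c' \<le> snd g" "prob {x \<in> space M. D' x \<le> c'} \<le> (1/2)^Suc n"
      using ex_small_lower_level[OF FM[OF D'_F] D'0 c(1) half] by blast
    then show "\<exists>g'. ?P (Suc n) g' \<and> ?Q n g g'" using D' c by (intro exI[of _ "(D', c')"]) simp
  qed
  then obtain f where f: "\<And>n. ?P n (f n)" "\<And>n. ?Q n (f n) (f (Suc n))" by blast
  define D c where "D = (\<lambda>n. fst (f n))" and "c = (\<lambda>n. snd (f n))"
  have mD: "martingale_density M F X n (D n)" and c: "0 < c n" "c n \<le> 1"
    and D_small: "prob {x \<in> space M. D n x \<le> c n} \<le> (1/2)^n"
    and D_0: "D 0 = (\<lambda>_. 1)" "c 0 = 1" for n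
    using f(1)[of n] f(1)[of 0] by (auto simp: D_def c_def)
  have D_Suc: "D (Suc n) x \<le> (1 + \<eta> n (c n)) * D n x" and c_Suc: "c (Suc n) \<le> c n"
    and DW: "\<exists>C. \<forall>x \<in> space M. D (Suc n) x * W n x \<le> C" for n x
    using f(2)[of n] by (auto simp: D_def c_def)
  have D_M[measurable]: "D n \<in> borel_measurable M" for n
    using mD[of n] by (auto simp: martingale_density_def intro: FM)
  have D0: "0 < D n x" and D1: "expectation (D n) = 1" and DX: "cond_null M (F t) (\<lambda>x. D n x * X t i x)" for n x t i
    using mD[of n] by (auto simp: martingale_density_def)
  have D_int: "integrable M (D n)" for n using D1[of n] not_integrable_integral_eq by fastforce
  define a where "a = (\<lambda>n. 2 - (1/2)^n :: real)"
  have a: "1 \<le> a n" "a n \<le> 2" for n by (simp_all add: a_def power_le_one)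
  have \<eta>: "0 < \<eta> n (c n)" "\<eta> n (c n) \<le> (1/2)^n / 8" "2 * \<eta> n (c n) = \<epsilon> * c n / 4 * (1/2)^n" for n
  proof -
    have "\<epsilon> * c n * (1/2)^n \<le> 1 * (1/2)^n"
      using c[of n] \<epsilon> by (intro mult_right_mono mult_le_one) auto
    then show "0 < \<eta> n (c n)" "\<eta> n (c n) \<le> (1/2)^n / 8" "2 * \<eta> n (c n) = \<epsilon> * c n / 4 * (1/2)^n"
      using c[of n] \<epsilon> by (auto simp: \<eta>_def)
  qed
  have dec: "decseq (\<lambda>n. D n x / a n)" for x
  proof (rule decseq_SucI)
    fix n
    have "\<eta> n (c n) * a n \<le> (1/2)^n / 8 * 2" using \<eta>[of n] a[of n] by (intro mult_mono) auto
    also have "\<dots> \<le> (1/2)^n / 2" by simp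
    finally have "(1 + \<eta> n (c n)) * a n \<le> a (Suc n)" by (simp add: a_def algebra_simps)
    then have "(1 + \<eta> n (c n)) * a n * D n x \<le> a (Suc n) * D n x"
      using D0[of n x] by (intro mult_right_mono) auto
    moreover have "D (Suc n) x * a n \<le> (1 + \<eta> n (c n)) * D n x * a n"
      using D_Suc[of n x] a[of n] by (intro mult_right_mono) auto
    ultimately have "D (Suc n) x * a n \<le> D n x * a (Suc n)" by (simp add: ac_simps)
    then show "D (Suc n) x / a (Suc n) \<le> D n x / a n"
      using a[of n] a[of "Suc n"] by (simp add: divide_simps ac_simps)
  qed
  have D_le: "D m x \<le> 2 * D n x" if "n \<le> m" for m n x
  proof -
    have "D m x / 2 \<le> D m x / a m" using a[of m] D0[of m x] by (intro divide_left_mono) auto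
    also have "\<dots> \<le> D n x / a n" using dec that by (auto simp: decseq_def)
    also have "\<dots> \<le> D n x / 1" using a[of n] D0[of n x] by (intro divide_left_mono) auto
    finally show ?thesis by simp
  qed
  define E where "E = (\<lambda>x. lim (\<lambda>n. D n x))"
  have E_lim: "(\<lambda>n. D n x) \<longlonglongrightarrow> E x" for x
  proof -
    have "0 \<le> D n x / a n" for n using D0[of n x] a[of n] by simp
    then obtain L where "(\<lambda>n. D n x / a n) \<longlonglongrightarrow> L"
      using decseq_convergent[OF dec] by blast
    moreover have "a \<longlonglongrightarrow> 2 - 0"
      unfolding a_def by (intro tendsto_intros LIMSEQ_power_zero) simp
    ultimately have "(\<lambda>n. D n x / a n * a n) \<longlonglongrightarrow> L * (2 - 0)" by (rule tendsto_mult)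
    moreover have "D n x / a n * a n = D n x" for n using a(1)[of n] by simp
    ultimately have "convergent (\<lambda>n. D n x)" by (auto simp: convergent_def)
    then show ?thesis unfolding E_def by (simp add: convergent_LIMSEQ_iff)
  qed
  have E_M[measurable]: "E \<in> borel_measurable M" unfolding E_def by measurable
  have E0: "0 \<le> E x" for x
    using D0 by (intro LIMSEQ_le_const[OF E_lim]) (auto intro: less_imp_le)
  have E_le: "E x \<le> 2 * D n x" for n x
    using D_le by (intro LIMSEQ_le_const2[OF E_lim]) auto
  have D2: "D n x \<le> 2" for n x using D_le[of 0 n x] by (simp add: D_0)
  have absD: "\<bar>D n x\<bar> \<le> 2" for n x using D2[of n x] D0[of n x] by simp
  have absE: "\<bar>E x\<bar> \<le> 2" for x using E_le[of x 0] E0[of x] by (simp add: D_0)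
  have E_int: "integrable M E" by (rule integrable_const_bound[of _ 2]) (use absE in auto)
  have lim_int: "(\<lambda>n. \<integral>x. D n x * g x \<partial>M) \<longlonglongrightarrow> (\<integral>x. E x * g x \<partial>M)"
    if g: "integrable M g" for g
  proof (rule integral_dominated_convergence[where w = "\<lambda>x. 2 * \<bar>g x\<bar>"])
    show "AE x in M. norm (D n x * g x) \<le> 2 * \<bar>g x\<bar>" for n
      using absD by (intro AE_I2) (simp add: abs_mult mult_right_mono)
    show "AE x in M. (\<lambda>n. D n x * g x) \<longlonglongrightarrow> E x * g x"
      by (intro AE_I2 tendsto_mult E_lim tendsto_const)
  qed (use g in auto)
  have E1: "expectation E = 1"
    using lim_int[of "\<lambda>_. 1"] D1 by (simp add: LIMSEQ_const_iff)
  \<comment> \<open>\<open>\<bar>z\<bar> = 2 max z 0 - z\<close>, and the difference \<open>z\<close> of two densities has mean zero\<close>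
  have step_L1: "expectation (\<lambda>x. \<bar>D (Suc n) x - D n x\<bar>) \<le> 2 * \<eta> n (c n)" for n
  proof -
    have "expectation (\<lambda>x. \<bar>D (Suc n) x - D n x\<bar>)
        \<le> expectation (\<lambda>x. 2 * \<eta> n (c n) * D n x - (D (Suc n) x - D n x))"
    proof (rule integral_mono)
      fix x
      have "0 < \<eta> n (c n) * D n x" using \<eta>(1)[of n] D0[of n x] by simp
      then show "\<bar>D (Suc n) x - D n x\<bar> \<le> 2 * \<eta> n (c n) * D n x - (D (Suc n) x - D n x)"
        using D_Suc[of n x] by (simp add: algebra_simps abs_if)
    qed (use D_int in auto)
    also have "\<dots> = 2 * \<eta> n (c n)" using D_int D1 by simp
    finally show ?thesis .
  qed
  have c_mono: "c m \<le> c n" if "n \<le> m" for m n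
    by (rule lift_Suc_antimono_le[of c, OF c_Suc that])
  have L1: "expectation (\<lambda>x. \<bar>D m x - D n x\<bar>) \<le> \<epsilon> * c n / 2 * ((1/2)^n - (1/2)^m)" if "n \<le> m" for m n
    using that
  proof (induction m rule: dec_induct)
    case (step m)
    have "expectation (\<lambda>x. \<bar>D (Suc m) x - D n x\<bar>)
        \<le> expectation (\<lambda>x. \<bar>D (Suc m) x - D m x\<bar> + \<bar>D m x - D n x\<bar>)"
      by (rule integral_mono) (use D_int in auto)
    also have "\<dots> = expectation (\<lambda>x. \<bar>D (Suc m) x - D m x\<bar>) + expectation (\<lambda>x. \<bar>D m x - D n x\<bar>)"
      by (rule Bochner_Integration.integral_add) (use D_int in auto)
    also have "\<dots> \<le> \<epsilon> * c m / 4 * (1/2)^m + \<epsilon> * c n / 2 * ((1/2)^n - (1/2)^m)"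
      using step_L1[of m] step.IH \<eta>(3)[of m] by (intro add_mono) simp_all
    also have "\<epsilon> * c m / 4 * (1/2)^m \<le> \<epsilon> * c n / 4 * (1/2)^m"
      using \<epsilon> c_mono[OF step.hyps(1)] by (intro mult_right_mono divide_right_mono mult_left_mono) auto
    finally show ?case by (simp add: algebra_simps)
  qed simp
  have L1_lim: "expectation (\<lambda>x. \<bar>E x - D n x\<bar>) \<le> \<epsilon> * c n / 2 * (1/2)^n" for n
  proof (rule LIMSEQ_le_const2)
    show "(\<lambda>m. expectation (\<lambda>x. \<bar>D m x - D n x\<bar>)) \<longlonglongrightarrow> expectation (\<lambda>x. \<bar>E x - D n x\<bar>)"
    proof (rule integral_dominated_convergence[where w = "\<lambda>_. 4"])
      show "AE x in M. (\<lambda>m. \<bar>D m x - D n x\<bar>) \<longlonglongrightarrow> \<bar>E x - D n x\<bar>"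
        by (intro AE_I2 tendsto_intros E_lim)
      show "AE x in M. norm \<bar>D m x - D n x\<bar> \<le> 4" for m
      proof (rule AE_I2)
        fix x show "norm \<bar>D m x - D n x\<bar> \<le> 4" using absD[of m x] absD[of n x] by simp
      qed
    qed auto
    have "\<epsilon> * c n / 2 * ((1/2)^n - (1/2)^m) \<le> \<epsilon> * c n / 2 * (1/2)^n" for m
      using \<epsilon> c[of n] by (intro mult_left_mono) auto
    then show "\<exists>N. \<forall>m\<ge>N. expectation (\<lambda>x. \<bar>D m x - D n x\<bar>) \<le> \<epsilon> * c n / 2 * (1/2)^n"
      using L1[of n] order_trans by blast
  qed
  have zero_small: "prob {x \<in> space M. E x \<le> 0} \<le> 2 * (1/2)^n" for n
  proof -
    have "prob {x \<in> space M. E x \<le> 0}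
        \<le> prob ({x \<in> space M. D n x \<le> c n} \<union> {x \<in> space M. c n \<le> \<bar>E x - D n x\<bar>})"
    proof (rule finite_measure_mono)
      show "{x \<in> space M. E x \<le> 0} \<subseteq> {x \<in> space M. D n x \<le> c n} \<union> {x \<in> space M. c n \<le> \<bar>E x - D n x\<bar>}"
      proof
        fix x assume x: "x \<in> {x \<in> space M. E x \<le> 0}"
        then have "\<bar>E x - D n x\<bar> = D n x" using E0[of x] D0[of n x] by simp
        then show "x \<in> {x \<in> space M. D n x \<le> c n} \<union> {x \<in> space M. c n \<le> \<bar>E x - D n x\<bar>}"
          using x by auto
      qed
    qed simp
    also have "\<dots> \<le> prob {x \<in> space M. D n x \<le> c n} + prob {x \<in> space M. c n \<le> \<bar>E x - D n x\<bar>}"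
      by (rule measure_Un_le) auto
    also have "prob {x \<in> space M. c n \<le> \<bar>E x - D n x\<bar>} \<le> expectation (\<lambda>x. \<bar>E x - D n x\<bar>) / c n"
      by (rule integral_Markov_inequality_measure[where A = "{}"]) (use E_int D_int c in auto)
    also have "\<dots> \<le> \<epsilon> * c n / 2 * (1/2)^n / c n"
      using L1_lim c[of n] by (intro divide_right_mono) auto
    also have "\<dots> \<le> (1/2)^n" using c[of n] \<epsilon> by simp
    finally show ?thesis using D_small[of n] by simp
  qed
  have "prob {x \<in> space M. E x \<le> 0} \<le> 0"
  proof (rule LIMSEQ_le_const)
    have "(\<lambda>n. 2 * (1/2::real)^n) \<longlonglongrightarrow> 2 * 0"
      by (intro tendsto_intros LIMSEQ_power_zero) simp
    then show "(\<lambda>n. 2 * (1/2::real)^n) \<longlonglongrightarrow> 0" by simp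
  qed (use zero_small in auto)
  then have "prob {x \<in> space M. E x \<le> 0} = 0" by (simp add: measure_le_0_iff)
  then have "AE x in M. \<not> E x \<le> 0"
    by (subst (asm) prob_eq_0) auto
  then have E_pos: "AE x in M. 0 < E x" by eventually_elim simp
  show ?thesis
  proof (rule bexI[of _ E], intro conjI allI)
    show "expectation (\<lambda>x. \<bar>E x - 1\<bar>) < \<epsilon>" using L1_lim[of 0] \<epsilon> by (simp add: D_0)
    show "cond_null M (F t) (\<lambda>x. E x * X t i x)" for t i
    proof (rule FF.cond_nullI_sets)
      have X_int: "integrable M (X t i)" by (rule cond_null_integrable[OF X(2)])
      show "integrable M (\<lambda>x. E x * X t i x)"
        by (rule integrable_mult_bounded[OF X_int E_M absE])
      fix A assume A: "A \<in> sets (F t)"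
      then have [measurable]: "A \<in> events" using F(1)[of t] by (auto simp: subalgebra_def)
      have i: "integrable M (\<lambda>x. indicator A x * X t i x)"
        using integrable_mult_indicator[OF _ X_int, of A] by simp
      have "(\<integral>x. D n x * (indicator A x * X t i x) \<partial>M) = 0" for n
      proof -
        have "(\<integral>x. indicator A x * (D n x * X t i x) \<partial>M) = 0"
          using integrable_mult_indicator[OF _ cond_null_integrable[OF DX], of A n t i] A
          by (intro FF.cond_null_integral[OF DX]) auto
        then show ?thesis by (simp add: ac_simps)
      qed
      then have "(\<integral>x. E x * (indicator A x * X t i x) \<partial>M) = 0"
        using lim_int[OF i] by (simp add: LIMSEQ_const_iff)
      then show "(\<integral>x. indicator A x * (E x * X t i x) \<partial>M) = 0" by (simp add: ac_simps)
    qed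
    show "\<exists>C. \<forall>x \<in> space M. E x * W n x \<le> C" for n
    proof -
      obtain C where C: "\<And>x. x \<in> space M \<Longrightarrow> D (Suc n) x * W n x \<le> C" using DW[of n] by blast
      have "E x * W n x \<le> 2 * C" if "x \<in> space M" for x
        using mult_right_mono[OF E_le[of x "Suc n"] W(2)[of n x]] C[OF that] by (simp add: mult.assoc)
      then show ?thesis by blast
    qed
  qed (use E0 E1 E_pos in auto)
qed

section \<open>Increments of local martingales\<close>

text \<open>
  The scaling is \<open>1 / (1 + m)\<close> where \<open>m\<close> is the conditional expectation of \<open>\<Sum>\<^sub>i \<bar>d\<^sub>i\<bar>\<close>, formed with values in
  \<open>[0, \<infinity>]\<close>; it is finite almost surely on each \<open>A\<^sub>n\<close>, hence almost surely, since these sets cover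
  almost everything.
\<close>
lemma (in finite_measure_subalgebra) ex_scaled_cond_null:
  fixes d :: "'i::finite \<Rightarrow> 'a \<Rightarrow> real" and A :: "nat \<Rightarrow> 'a set"
  assumes d[measurable]: "\<And>i. d i \<in> borel_measurable M" and A: "\<And>n. A n \<in> sets F"
    and ev: "AE x in M. \<exists>N. \<forall>n\<ge>N. x \<in> A n"
    and null: "\<And>n i. cond_null M F (\<lambda>x. indicator (A n) x * d i x)"
  shows "\<exists>\<xi> \<in> borel_measurable F. (\<forall>x. 0 < \<xi> x \<and> \<xi> x \<le> 1) \<and> (\<forall>i. cond_null M F (\<lambda>x. \<xi> x * d i x))"
proof -
  have [measurable]: "A n \<in> sets F" "A n \<in> sets M" for n
    using A subalg by (auto simp: subalgebra_def)
  define g where "g = (\<lambda>x. \<Sum>i\<in>UNIV. \<bar>d i x\<bar>)"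
  have [measurable]: "g \<in> borel_measurable M" unfolding g_def by measurable
  have g0: "0 \<le> g x" for x by (simp add: g_def sum_nonneg)
  have dg: "\<bar>d i x\<bar> \<le> g x" for i x
    unfolding g_def by (rule member_le_sum[of i UNIV "\<lambda>i. \<bar>d i x\<bar>"]) auto
  define m where "m = nn_cond_exp M F (\<lambda>x. ennreal (g x))"
  have [measurable]: "m \<in> borel_measurable F" "m \<in> borel_measurable M" by (simp_all add: m_def)
  have "AE x in M. indicator (A n) x * m x \<noteq> \<infinity>" for n
  proof (rule nn_integral_noteq_infinite)
    have "(\<integral>\<^sup>+x. indicator (A n) x * m x \<partial>M) = (\<integral>\<^sup>+x. indicator (A n) x * ennreal (g x) \<partial>M)"
      unfolding m_def by (rule nn_cond_exp_intg) auto
    also have "\<dots> = (\<integral>\<^sup>+x. ennreal (\<Sum>i\<in>UNIV. \<bar>indicator (A n) x * d i x\<bar>) \<partial>M)"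
      by (intro nn_integral_cong) (auto simp: g_def indicator_def)
    also have "\<dots> < \<infinity>"
    proof -
      have "integrable M (\<lambda>x. \<Sum>i\<in>UNIV. \<bar>indicator (A n) x * d i x\<bar>)"
        using cond_null_integrable[OF null] by (intro Bochner_Integration.integrable_sum integrable_abs)
      then show ?thesis by (subst nn_integral_eq_integral) (auto intro: sum_nonneg)
    qed
    finally show "(\<integral>\<^sup>+x. indicator (A n) x * m x \<partial>M) \<noteq> \<infinity>" by simp
  qed simp
  then have "AE x in M. \<forall>n. indicator (A n) x * m x \<noteq> \<infinity>" by (simp add: AE_all_countable)
  with ev have m_fin: "AE x in M. m x < \<infinity>"
  proof eventually_elim
    case (elim x)
    then obtain n where "x \<in> A n" by blast
    with elim(2)[rule_format, of n] show ?case by (simp add: less_top)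
  qed
  define \<xi> where "\<xi> = (\<lambda>x. 1 / (1 + enn2real (m x)))"
  have \<xi>_F[measurable]: "\<xi> \<in> borel_measurable F" unfolding \<xi>_def by measurable
  have [measurable]: "\<xi> \<in> borel_measurable M" by (rule measurable_from_subalg[OF subalg \<xi>_F])
  have \<xi>: "0 < \<xi> x" "\<xi> x \<le> 1" for x
    using enn2real_nonneg[of "m x"] by (auto simp: \<xi>_def add_pos_nonneg simp del: enn2real_nonneg)
  have abs_\<xi>: "\<bar>\<xi> x\<bar> \<le> 1" for x using \<xi>[of x] by simp
  have \<xi>g: "integrable M (\<lambda>x. \<xi> x * g x)"
  proof (rule integrableI_nonneg)
    have "(\<integral>\<^sup>+x. ennreal (\<xi> x * g x) \<partial>M) = (\<integral>\<^sup>+x. ennreal (\<xi> x) * ennreal (g x) \<partial>M)"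
      using \<xi> g0 by (intro nn_integral_cong) (auto simp: ennreal_mult less_imp_le)
    also have "\<dots> = (\<integral>\<^sup>+x. ennreal (\<xi> x) * m x \<partial>M)"
      unfolding m_def by (rule nn_cond_exp_intg[symmetric]) auto
    also have "\<dots> \<le> (\<integral>\<^sup>+x. 1 \<partial>M)"
    proof (rule nn_integral_mono_AE)
      show "AE x in M. ennreal (\<xi> x) * m x \<le> 1"
        using m_fin
      proof eventually_elim
        case (elim x)
        then obtain r where r: "m x = ennreal r" "0 \<le> r" by (cases "m x") auto
        have "ennreal (\<xi> x) * m x = ennreal (r / (1 + r))"
          using r \<xi>[of x] by (simp add: \<xi>_def ennreal_mult[symmetric])
        also have "\<dots> \<le> ennreal 1" using r by (intro ennreal_leI) simp
        finally show ?case by simp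
      qed
    qed
    also have "\<dots> < \<infinity>" by (simp add: less_top emeasure_eq_measure)
    finally show "(\<integral>\<^sup>+x. ennreal (\<xi> x * g x) \<partial>M) < \<infinity>" .
  qed (use \<xi> g0 in \<open>auto simp: less_imp_le\<close>)
  have "cond_null M F (\<lambda>x. \<xi> x * d i x)" for i
  proof (rule cond_nullI_sets)
    show int: "integrable M (\<lambda>x. \<xi> x * d i x)"
      by (rule Bochner_Integration.integrable_bound[OF \<xi>g])
        (use \<xi> dg g0 in \<open>auto simp: abs_mult less_imp_le\<close>)
    fix B assume B[measurable]: "B \<in> sets F"
    then have [measurable]: "B \<in> sets M" using subalg by (auto simp: subalgebra_def)
    have z: "(\<integral>x. (indicator B x * \<xi> x) * (indicator (A n) x * d i x) \<partial>M) = 0" for n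
    proof (rule cond_null_integral[OF null])
      show "integrable M (\<lambda>x. (indicator B x * \<xi> x) * (indicator (A n) x * d i x))"
        by (rule integrable_mult_bounded[OF cond_null_integrable[OF null], where B = 1])
          (use abs_\<xi> in \<open>auto simp: indicator_def\<close>)
    qed measurable
    have "(\<lambda>n. \<integral>x. (indicator B x * \<xi> x) * (indicator (A n) x * d i x) \<partial>M)
        \<longlonglongrightarrow> (\<integral>x. indicator B x * (\<xi> x * d i x) \<partial>M)"
    proof (rule integral_dominated_convergence[where w = "\<lambda>x. \<bar>\<xi> x * d i x\<bar>"])
      show "AE x in M. (\<lambda>n. indicator B x * \<xi> x * (indicator (A n) x * d i x)) \<longlonglongrightarrow> indicator B x * (\<xi> x * d i x)"
        using ev
      proof eventually_elim
        case (elim x)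
        then obtain N where "\<And>n. N \<le> n \<Longrightarrow> x \<in> A n" by blast
        then have "eventually (\<lambda>n. indicator B x * \<xi> x * (indicator (A n) x * d i x) = indicator B x * (\<xi> x * d i x)) sequentially"
          by (intro eventually_sequentiallyI[of N]) simp
        then show ?case by (rule tendsto_eventually)
      qed
      show "integrable M (\<lambda>x. \<bar>\<xi> x * d i x\<bar>)" using int by (rule integrable_abs)
    qed (auto simp: indicator_def)
    then show "(\<integral>x. indicator B x * (\<xi> x * d i x) \<partial>M) = 0"
      unfolding z by (simp add: LIMSEQ_const_iff)
  qed
  then show ?thesis using \<xi>_F \<xi> by blast
qed

text \<open>
  The process \<open>s\<close> is an adapted version of \<open>S\<close>. It is needed because \<open>S\<close> itself is only almost surely
  equal to an adapted process, and null sets need not belong to the filtration. On the event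
  \<open>{\<tau>\<^sub>n > t}\<close>, which belongs to \<open>F\<^sub>t\<close>, the increments of \<open>S\<close> and of the stopped process agree.
\<close>
lemma local_martingale_increments:
  fixes S :: "nat \<Rightarrow> 'a \<Rightarrow> real ^ 'd"
  assumes "prob_space P" and F: "\<And>t. subalgebra P (F t)" and S: "local_martingale P F S"
  shows "\<exists>s \<xi>. (\<forall>t i. s t i \<in> borel_measurable (F t)) \<and> (\<forall>t. \<xi> t \<in> borel_measurable (F t)) \<and>
    (\<forall>t. AE x in P. \<forall>i. s t i x = S t x $ i) \<and> (\<forall>t x. 0 < \<xi> t x \<and> \<xi> t x \<le> (1::real)) \<and>
    (\<forall>t i. cond_null P (F t) (\<lambda>x. \<xi> t x * (s (Suc t) i x - s t i x)))"
proof -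
  interpret prob_space P by fact
  interpret FF: finite_measure_subalgebra P "F t" for t by standard (rule F)
  obtain \<tau> where \<tau>: "\<And>n. ext_stopping_time F (\<tau> n)" "AE x in P. (\<lambda>n. \<tau> n x) \<longlonglongrightarrow> \<infinity>"
    and mart: "\<And>n. martingale P F (\<lambda>t x. indicator {x. \<tau> n x > 0} x *\<^sub>R stopped S (\<tau> n) t x)"
    using S by (auto simp: local_martingale_def)
  define Y where "Y = (\<lambda>n t x. indicator {x. \<tau> n x > 0} x *\<^sub>R stopped S (\<tau> n) t x)"
  have Y_int: "integrable P (\<lambda>x. Y n t x $ i)" for n t i
  proof -
    have "integrable P (Y n t)" using mart[of n] by (simp add: martingale_def Y_def)
    then show ?thesis by (rule integrable_bounded_linear[OF bounded_linear_vec_nth])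
  qed
  have Y_cond: "AE x in P. real_cond_exp P (F t) (\<lambda>x. Y n (Suc t) x $ i) x = Y n t x $ i" for n t i
    using mart[of n] by (simp add: martingale_def Y_def)
  have Y_S: "Y n t x = S t x" "Y n (Suc t) x = S (Suc t) x" if "enat t < \<tau> n x" for n t x
  proof -
    have "0 < \<tau> n x" using that by (metis enat_0 le_less_trans zero_le)
    moreover have "min (enat t) (\<tau> n x) = enat t" "min (enat (Suc t)) (\<tau> n x) = enat (Suc t)"
      using that by (auto simp: min_def Suc_ile_eq)
    ultimately show "Y n t x = S t x" "Y n (Suc t) x = S (Suc t) x"
      by (simp_all add: Y_def stopped_def)
  qed
  have ev: "AE x in P. \<exists>N. \<forall>n\<ge>N. enat t < \<tau> n x" for t
    using \<tau>(2)
  proof eventually_elim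
    case (elim x)
    then show ?case using order_tendstoD(1)[OF elim, of "enat t"] by (simp add: eventually_sequentially)
  qed
  define s where "s = (\<lambda>t i x. lim (\<lambda>n. real_cond_exp P (F t) (\<lambda>x. Y n (Suc t) x $ i) x))"
  have s_F[measurable]: "s t i \<in> borel_measurable (F t)" for t i unfolding s_def by measurable
  have s_S1: "AE x in P. s t i x = S t x $ i" for t i
  proof -
    have "AE x in P. \<forall>n. real_cond_exp P (F t) (\<lambda>x. Y n (Suc t) x $ i) x = Y n t x $ i"
      using Y_cond by (simp add: AE_all_countable)
    then show ?thesis using ev[of t]
    proof eventually_elim
      case (elim x)
      then obtain N where "\<And>n. N \<le> n \<Longrightarrow> enat t < \<tau> n x" by blast
      then have "eventually (\<lambda>n. Y n t x $ i = S t x $ i) sequentially"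
        by (intro eventually_sequentiallyI[of N]) (simp add: Y_S)
      then show ?case unfolding s_def using elim(1) by (intro limI tendsto_eventually) simp
    qed
  qed
  have s_S: "AE x in P. \<forall>i. s t i x = S t x $ i" for t
    using s_S1 by (simp add: AE_all_countable)
  have s_M[measurable]: "s t i \<in> borel_measurable P" for t i by (rule measurable_from_subalg[OF F s_F])
  have "\<exists>\<xi> \<in> borel_measurable (F t). (\<forall>x. 0 < \<xi> x \<and> \<xi> x \<le> 1) \<and>
      (\<forall>i. cond_null P (F t) (\<lambda>x. \<xi> x * (s (Suc t) i x - s t i x)))" for t
  proof (rule FF.ex_scaled_cond_null)
    define A where "A = (\<lambda>n. {x \<in> space P. enat t < \<tau> n x})"
    show A: "A n \<in> sets (F t)" for n
    proof -
      have "Measurable.pred (F t) (\<lambda>x. \<not> \<tau> n x \<le> enat t)"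
        using \<tau>(1)[of n] by (intro pred_intros_logic) (simp add: ext_stopping_time_def)
      then have "{x \<in> space (F t). \<not> \<tau> n x \<le> enat t} \<in> sets (F t)" by (simp add: pred_def)
      moreover have "{x \<in> space (F t). \<not> \<tau> n x \<le> enat t} = A n"
        using F[of t] by (auto simp: A_def subalgebra_def)
      ultimately show ?thesis by simp
    qed
    show "AE x in P. \<exists>N. \<forall>n\<ge>N. x \<in> A n"
      using ev[of t] AE_space by eventually_elim (auto simp: A_def)
    have A_M: "A n \<in> sets P" for n using A[of n] F[of t] by (auto simp: subalgebra_def)
    show "cond_null P (F t) (\<lambda>x. indicator (A n) x * (s (Suc t) i x - s t i x))" for n i
    proof -
      let ?c = "real_cond_exp P (F t) (\<lambda>x. Y n (Suc t) x $ i)"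
      have null: "cond_null P (F t) (\<lambda>x. Y n (Suc t) x $ i - ?c x)"
        by (rule FF.cond_null_minus_cond_exp[OF Y_int])
      have "cond_null P (F t) (\<lambda>x. indicator (A n) x * (Y n (Suc t) x $ i - ?c x))"
        using integrable_mult_indicator[OF A_M cond_null_integrable[OF null]] A
        by (intro FF.cond_null_mult[OF null]) auto
      then show ?thesis
      proof (rule FF.cond_null_cong_AE)
        show "AE x in P. indicator (A n) x * (Y n (Suc t) x $ i - ?c x) = indicator (A n) x * (s (Suc t) i x - s t i x)"
          using Y_cond[of t n i] s_S1[of t i] s_S1[of "Suc t" i]
        proof eventually_elim
          case (elim x)
          then show ?case by (cases "x \<in> A n") (auto simp: A_def Y_S)
        qed
        show "(\<lambda>x. indicator (A n) x * (s (Suc t) i x - s t i x)) \<in> borel_measurable P"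
          using A_M by measurable
      qed
    qed
  qed measurable
  then have "\<exists>\<xi>. \<forall>t. \<xi> t \<in> borel_measurable (F t) \<and> (\<forall>x. 0 < \<xi> t x \<and> \<xi> t x \<le> 1) \<and>
      (\<forall>i. cond_null P (F t) (\<lambda>x. \<xi> t x * (s (Suc t) i x - s t i x)))"
    by (intro choice) blast
  then obtain \<xi> where "\<forall>t. \<xi> t \<in> borel_measurable (F t) \<and> (\<forall>x. 0 < \<xi> t x \<and> \<xi> t x \<le> 1) \<and>
      (\<forall>i. cond_null P (F t) (\<lambda>x. \<xi> t x * (s (Suc t) i x - s t i x)))" by blast
  then show ?thesis using s_F s_S by (intro exI[of _ s] exI[of _ \<xi>]) blast
qed

section \<open>Equivalent martingale measures with finite moments\<close>

lemma power_le_fact_mult_exp: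
  assumes "0 \<le> (x::real)"
  shows "x ^ p \<le> fact p * exp x"
proof -
  have "x ^ p / fact p \<le> exp x"
  proof -
    have "(\<Sum>n\<in>{p}. x ^ n /\<^sub>R fact n) \<le> (\<Sum>n. x ^ n /\<^sub>R fact n)"
      by (rule sum_le_suminf[OF summable_exp_generic]) (use assms in auto)
    then show ?thesis by (simp add: exp_def divide_inverse mult.commute)
  qed
  then show ?thesis by (simp add: field_simps)
qed

theorem corollary1p2:
  fixes P :: "'a measure"
    and F :: "nat \<Rightarrow> 'a measure"
    and S :: "nat \<Rightarrow> 'a \<Rightarrow> real ^ 'd"
    and \<epsilon> :: real
  assumes "prob_space P"
    and "filtration (space P) F"
    and "\<And>t. subalgebra P (F t)"
    and "local_martingale P F S"
    and "\<epsilon> > 0"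
  shows "\<exists>Q :: 'a measure.
           prob_space Q \<and> equivalent_measures P Q \<and>
           martingale Q F S \<and>
           tv_norm P Q < \<epsilon> \<and>
           (\<forall>t. \<forall>p::nat. p \<ge> 1 \<longrightarrow> integrable Q (\<lambda>\<omega>. norm (S t \<omega>) ^ p))"
proof -
  interpret prob_space P by fact
  note F = assms(3)
  interpret FF: finite_measure_subalgebra P "F t" for t by standard (rule F)
  have FF_sub: "subalgebra (F t) (F s)" if "s \<le> t" for s t
    using filtration.sets_F_mono[OF assms(2) that] filtration.space_F[OF assms(2)]
    by (simp add: subalgebra_def)
  have [measurable]: "S t \<in> borel_measurable P" for t
    using assms(4) by (simp add: local_martingale_def)
  obtain s \<xi> where s_F: "\<And>t i. s t i \<in> borel_measurable (F t)" and \<xi>_F: "\<And>t. \<xi> t \<in> borel_measurable (F t)"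
    and s_S: "\<And>t. AE x in P. \<forall>i. s t i x = S t x $ i" and \<xi>: "\<And>t x. 0 < \<xi> t x" "\<And>t x. \<xi> t x \<le> 1"
    and null: "\<And>t i. cond_null P (F t) (\<lambda>x. \<xi> t x * (s (Suc t) i x - s t i x))"
    using local_martingale_increments[OF assms(1) F assms(4)] by blast
  have [measurable]: "s t i \<in> borel_measurable P" "\<xi> t \<in> borel_measurable P" for t i
    by (rule measurable_from_subalg[OF F s_F], rule measurable_from_subalg[OF F \<xi>_F])
  have up: "f \<in> borel_measurable (F (Suc t))" if "f \<in> borel_measurable (F t)" for f :: "'a \<Rightarrow> real" and t
    using measurable_from_subalg[OF FF_sub that, of "Suc t"] by simp
  define X where "X = (\<lambda>t i x. \<xi> t x * (s (Suc t) i x - s t i x))"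
  have X_F: "X t i \<in> borel_measurable (F (Suc t))" for t i
    unfolding X_def by (intro borel_measurable_times borel_measurable_diff up[OF \<xi>_F] s_F up[OF s_F])
  have [measurable]: "X t i \<in> borel_measurable P" for t i by (rule measurable_from_subalg[OF F X_F])
  have X_null: "cond_null P (F t) (X t i)" for t i using null by (simp add: X_def)
  \<comment> \<open>one exponential weight dominates all powers of the norm\<close>
  define W where "W = (\<lambda>t x. exp (\<Sum>i\<in>UNIV. \<bar>s t i x\<bar>))"
  have W_F: "W t \<in> borel_measurable (F (Suc t))" for t
    unfolding W_def by (intro measurable_compose[OF _ borel_measurable_exp] borel_measurable_sum borel_measurable_abs up[OF s_F])
  \<comment> \<open>the construction of the density needs a bound below one\<close>
  define \<delta> where "\<delta> = min \<epsilon> (1/2)"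
  have \<delta>: "0 < \<delta>" "\<delta> < 1" "\<delta> \<le> \<epsilon>" using assms(5) by (auto simp: \<delta>_def)
  obtain D where [measurable]: "D \<in> borel_measurable P" and D0: "\<And>x. 0 \<le> D x" "AE x in P. 0 < D x"
    and D1: "expectation D = 1" "expectation (\<lambda>x. \<bar>D x - 1\<bar>) < \<delta>"
    and DX: "\<And>t i. cond_null P (F t) (\<lambda>x. D x * X t i x)"
    and DW: "\<And>n. \<exists>C. \<forall>x \<in> space P. D x * W n x \<le> C"
  proof -
    have "0 \<le> W n x" for n x by (simp add: W_def)
    from ex_equivalent_density[of F X W \<delta>, OF F FF_sub X_F X_null W_F this \<delta>(1,2)] that show thesis by blast
  qed
  have D_int: "integrable P D" using D1(1) not_integrable_integral_eq by fastforce
  define Q where "Q = density P D"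
  have Q: "sets Q = sets P" "space Q = space P" by (auto simp: Q_def)
  interpret Q: prob_space Q
    unfolding Q_def by (rule prob_space_density_real[OF D_int D0(1) D1(1)])
  have FQ: "subalgebra Q (F t)" for t using F[of t] by (simp add: Q subalgebra_def)
  interpret QF: finite_measure_subalgebra Q "F t" for t by standard (rule FQ)
  have PQ: "absolutely_continuous P Q"
    unfolding Q_def by (rule absolutely_continuousI_density) simp
  have QP: "absolutely_continuous Q P"
    unfolding absolutely_continuous_def
  proof
    fix N assume "N \<in> null_sets Q"
    then have "N \<in> sets P" "AE x in P. x \<in> N \<longrightarrow> ennreal (D x) = 0"
      unfolding Q_def by (auto simp: null_sets_density_iff)
    moreover from this(2) D0(2) have "AE x in P. x \<notin> N" by eventually_elim auto
    ultimately show "N \<in> null_sets P" by (simp add: AE_iff_null_sets)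
  qed
  have AE_Q: "AE x in Q. R x" if "AE x in P. R x" for R
    using that unfolding Q_def by (subst AE_density) auto
  have equiv: "equivalent_measures P Q"
    using PQ QP Q by (simp add: equivalent_measures_def)
  have tv: "tv_norm P Q < \<epsilon>"
  proof -
    have "AE x in P. ennreal (D x) = RN_deriv P Q x"
      by (rule RN_deriv_unique) (auto simp: Q_def)
    then have "AE x in P. \<bar>enn2real (RN_deriv P Q x) - 1\<bar> = \<bar>D x - 1\<bar>"
      by eventually_elim (metis D0(1) enn2real_ennreal)
    then have "tv_norm P Q = expectation (\<lambda>x. \<bar>D x - 1\<bar>)"
      unfolding tv_norm_def by (intro integral_cong_AE) auto
    then show ?thesis using D1 \<delta> by simp
  qed
  have mom: "integrable Q (\<lambda>x. norm (S t x) ^ p)" for t p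
  proof -
    obtain C where C: "\<And>x. x \<in> space P \<Longrightarrow> D x * W t x \<le> C" using DW by blast
    have "AE x in P. norm (D x * norm (S t x) ^ p) \<le> fact p * C"
      using s_S[of t] AE_space
    proof eventually_elim
      case (elim x)
      have "norm (S t x) \<le> (\<Sum>i\<in>UNIV. \<bar>s t i x\<bar>)"
        using norm_le_l1_cart[of "S t x"] elim by simp
      then have "norm (S t x) ^ p \<le> (\<Sum>i\<in>UNIV. \<bar>s t i x\<bar>) ^ p" by (rule power_mono) simp
      also have "\<dots> \<le> fact p * W t x" unfolding W_def by (rule power_le_fact_mult_exp) (simp add: sum_nonneg)
      finally have "D x * norm (S t x) ^ p \<le> D x * (fact p * W t x)" by (intro mult_left_mono D0)
      also have "\<dots> = fact p * (D x * W t x)" by simp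
      also have "\<dots> \<le> fact p * C" using C elim by (intro mult_left_mono) auto
      finally show ?case using D0(1)[of x] by (simp add: abs_mult)
    qed
    then have "integrable P (\<lambda>x. D x * norm (S t x) ^ p)" by (rule integrable_const_bound) simp
    then show ?thesis unfolding Q_def using D0 by (subst integrable_real_density) auto
  qed
  have S_Q: "S t \<in> borel_measurable Q" for t by (simp add: Q_def)
  have S_int: "integrable Q (S t)" for t
    by (rule integrable_norm_cancel[OF _ S_Q]) (use mom[of t 1] in simp)
  have mart: "AE x in Q. real_cond_exp Q (F t) (\<lambda>x. S (Suc t) x $ i) x = S t x $ i" for t i
  proof -
    have Si_int: "integrable Q (\<lambda>x. S t x $ i)" for t
      using S_int by (rule integrable_bounded_linear[OF bounded_linear_vec_nth])
    have [measurable]: "s t i \<in> borel_measurable Q" "(\<lambda>x. S t x $ i) \<in> borel_measurable Q" for t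
      by (simp add: Q_def) (rule borel_measurable_integrable[OF Si_int])
    have eq: "AE x in Q. s t i x = S t x $ i" for t using AE_Q[OF s_S[of t]] by eventually_elim simp
    have s_int: "integrable Q (s t i)" for t
      using Si_int[of t] eq[of t] by (subst integrable_cong_AE[of _ Q "\<lambda>x. S t x $ i"]) auto
    have XQ: "cond_null Q (F t) (X t i)"
      using DX[of t i] cond_null_density[OF FF.sigma_finite_subalgebra_axioms QF.sigma_finite_subalgebra_axioms[unfolded Q_def]] D0
      by (auto simp: Q_def)
    \<comment> \<open>under \<open>Q\<close> the increments are integrable without the scaling \<open>\<xi>\<close>, which can thus be divided out\<close>
    have inv: "(\<lambda>x. inverse (\<xi> t x) * X t i x) = (\<lambda>x. s (Suc t) i x - s t i x)"
      using \<xi>(1) less_imp_neq[OF \<xi>(1)] by (auto simp: X_def fun_eq_iff field_simps)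
    have "cond_null Q (F t) (\<lambda>x. inverse (\<xi> t x) * X t i x)"
      using \<xi>_F by (intro QF.cond_null_mult[OF XQ]) (auto simp: inv s_int)
    then have "AE x in Q. real_cond_exp Q (F t) (\<lambda>x. s (Suc t) i x - s t i x) x = 0"
      unfolding inv by (simp add: cond_null_def)
    moreover have "AE x in Q. real_cond_exp Q (F t) (\<lambda>x. s (Suc t) i x - s t i x) x
        = real_cond_exp Q (F t) (s (Suc t) i) x - real_cond_exp Q (F t) (s t i) x"
      by (rule QF.real_cond_exp_diff[OF s_int s_int])
    moreover have "AE x in Q. real_cond_exp Q (F t) (s t i) x = s t i x"
      by (rule QF.real_cond_exp_F_meas[OF s_int s_F])
    moreover have "AE x in Q. real_cond_exp Q (F t) (s (Suc t) i) x
        = real_cond_exp Q (F t) (\<lambda>x. S (Suc t) x $ i) x"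
      by (rule QF.real_cond_exp_cong[OF eq]) auto
    ultimately show ?thesis using eq[of t] by eventually_elim simp
  qed
  show ?thesis
    using Q.prob_space_axioms equiv S_int mart tv mom
    by (intro exI[of _ Q]) (auto simp: martingale_def)
qed

end
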